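(* Let $x=P(x)$ be a PPS in simple normal form with least fixed point $q^*>0$. (i) If $q^*<\mathbf 1$ and $0\le y<\mathbf 1$, then $(I-P'(\tfrac12(y+q^* )))^{-1}$ exists, is non-negative, and $$\big\|(I-P'(\tfrac12(y+q^* )))^{-1}\big\|_\infty\le 2^{10|P|}\max\{2(\mathbf 1-y)_{\min}^{-1},\,2^{|P|}\}.$$ (ii) If $q^*=\mathbf 1$, $x=P(x)$ is strongly connected, and $0\le y<\mathbf 1$, then $(I-P'(y))^{-1}$ exists, is non-negative, and $\|(I-P'(y))^{-1}\|_\infty\le 2^{4|P|}\frac{1}{(\mathbf 1-y)_{\min}}$.
   Context: A PPS is a system $x_i=P_i(x)$, $i=1,\dots,n$, each $P_i$ a polynomial with rational nonnegative coefficients (including the constant term) summing to at most $1$; it is in simple normal form if each $P_i$ is either $a_{i,0}+\sum_ja_{i,j}x_j$ (with $a_{i,j}\ge0$, $\sum_{j\ge0}a_{i,j}\le1$) or $x_jx_k$. $|P|$ is its total bit-encoding length (sparse form, binary numbers). $q^*$ is its least fixed point in $[0,1]^n$. $P'(x)$ is the Jacobian matrix $(\partial P_i/\partial x_j)$. The dependency graph has vertices $x_1,\dots,x_n$ and an edge $(x_i,x_j)$ iff $x_j$ occurs with positive coefficient in $P_i$; the PPS is strongly connected if this graph is strongly connected. $\mathbf 1$ is the all-ones vector, $v_{\min}=\min_iv_i$, $\|A\|_\infty=\max_i\sum_j|A_{ij}|$; vector inequalities are coordinatewise. *)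

theory Defs
  imports
    "HOL-Analysis.Analysis"
    "HOL-Library.Poly_Mapping"
    "HOL-Library.Log_Nat"
begin

text \<open>Sparse multivariate polynomials with rational coefficients in the variables \<open>x j\<close>,
  \<open>j :: 'n\<close>. A monomial maps each variable to its exponent, and the \<open>keys\<close> of a polynomial are
  the monomials that occur in it. A system assigns a polynomial to each variable, so the number
  of equations and variables is \<open>CARD('n)\<close>.\<close>

type_synonym 'n monomial = "'n \<Rightarrow>\<^sub>0 nat"
type_synonym 'n polynomial = "'n monomial \<Rightarrow>\<^sub>0 rat"
type_synonym 'n system = "'n \<Rightarrow> 'n polynomial"

definition eval_polynomial :: "'n::finite polynomial \<Rightarrow> real^'n \<Rightarrow> real" where
  "eval_polynomial p x =
     (\<Sum>m\<in>Poly_Mapping.keys p.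
        real_of_rat (Poly_Mapping.lookup p m) * (\<Prod>j\<in>UNIV. (x $ j) ^ Poly_Mapping.lookup m j))"

definition eval_system :: "'n::finite system \<Rightarrow> real^'n \<Rightarrow> real^'n" where
  "eval_system P x = (\<chi> i. eval_polynomial (P i) x)"

definition system_jacobian :: "'n::finite system \<Rightarrow> real^'n \<Rightarrow> real^'n^'n" where
  "system_jacobian P x = jacobian (eval_system P) (at x)"

definition is_PPS :: "'n::finite system \<Rightarrow> bool" where
  "is_PPS P \<longleftrightarrow>
     (\<forall>i. (\<forall>m. 0 \<le> Poly_Mapping.lookup (P i) m) \<and>
          (\<Sum>m\<in>Poly_Mapping.keys (P i). Poly_Mapping.lookup (P i) m) \<le> 1)"

definition linear_form :: "'n::finite polynomial \<Rightarrow> bool" where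
  "linear_form p \<longleftrightarrow>
     (\<exists>a0 a. p = Poly_Mapping.single 0 a0 +
        (\<Sum>j\<in>UNIV. Poly_Mapping.single (Poly_Mapping.single j 1) (a j)))"

text \<open>The product \<open>x j * x k\<close>; the case \<open>j = k\<close> is allowed and gives the square of \<open>x j\<close>.\<close>

definition product_form :: "'n::finite polynomial \<Rightarrow> bool" where
  "product_form p \<longleftrightarrow>
     (\<exists>j k. p = Poly_Mapping.single (Poly_Mapping.single j 1 + Poly_Mapping.single k 1) 1)"

text \<open>The sign and sum conditions on the coefficients of linear forms are part of \<open>is_PPS\<close>.\<close>

definition is_SNF_PPS :: "'n::finite system \<Rightarrow> bool" where
  "is_SNF_PPS P \<longleftrightarrow> is_PPS P \<and> (\<forall>i. linear_form (P i) \<or> product_form (P i))"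

definition is_least_fixed_point :: "'n::finite system \<Rightarrow> real^'n \<Rightarrow> bool" where
  "is_least_fixed_point P q \<longleftrightarrow>
     q \<in> {0..1} \<and> eval_system P q = q \<and>
     (\<forall>x\<in>{0..1}. eval_system P x = x \<longrightarrow> q \<le> x)"

definition dependency_graph :: "'n::finite system \<Rightarrow> ('n \<times> 'n) set" where
  "dependency_graph P =
     {(i, j). \<exists>m. 0 < Poly_Mapping.lookup (P i) m \<and> 0 < Poly_Mapping.lookup m j}"

definition strongly_connected_system :: "'n::finite system \<Rightarrow> bool" where
  "strongly_connected_system P \<longleftrightarrow> (\<forall>i j. (i, j) \<in> (dependency_graph P)\<^sup>*)"

text \<open>Encoding length. A polynomial is the list of its nonzero terms. A term consists of numerator
  and denominator (in lowest terms) of its coefficient and, for each variable that occurs in it,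
  the index of that variable and its exponent, everything in binary. Variable indices have the
  fixed width of the binary representation of the number of variables.\<close>

definition rat_length :: "rat \<Rightarrow> nat" where
  "rat_length r = (case quotient_of r of (a, b) \<Rightarrow> nat (bitlen \<bar>a\<bar>) + nat (bitlen b))"

definition monomial_length :: "'n::finite monomial \<Rightarrow> nat" where
  "monomial_length m =
     (\<Sum>j\<in>Poly_Mapping.keys m.
        nat (bitlen (int CARD('n))) + nat (bitlen (int (Poly_Mapping.lookup m j))))"

definition polynomial_length :: "'n::finite polynomial \<Rightarrow> nat" where
  "polynomial_length p =
     (\<Sum>m\<in>Poly_Mapping.keys p. rat_length (Poly_Mapping.lookup p m) + monomial_length m)"

definition encoding_length :: "'n::finite system \<Rightarrow> nat" where
  "encoding_length P = (\<Sum>i\<in>UNIV. polynomial_length (P i))"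

definition vec_min :: "real^'n::finite \<Rightarrow> real" where
  "vec_min v = (MIN i. v $ i)"

definition matrix_norm_inf :: "real^'n::finite^'m::finite \<Rightarrow> real" where
  "matrix_norm_inf A = (MAX i. \<Sum>j\<in>UNIV. \<bar>A $ i $ j\<bar>)"

definition nonneg_matrix :: "real^'n::finite^'m::finite \<Rightarrow> bool" where
  "nonneg_matrix A \<longleftrightarrow> (\<forall>i j. 0 \<le> A $ i $ j)"

text \<open>Strict coordinatewise order; the library's \<open><\<close> on vectors only means \<open>\<le>\<close> and not equal.\<close>

definition vec_less :: "real^'n::finite \<Rightarrow> real^'n \<Rightarrow> bool" where
  "vec_less u v \<longleftrightarrow> (\<forall>i. u $ i < v $ i)"

end

theory Submission
  imports Defs
begin

text \<open>
  If \<open>B\<close> is nonnegative, \<open>u > 0\<close>, \<open>B u \<le> u\<close>, and from every row there is a path in the support of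
  \<open>B\<close> to a row with slack \<open>u i - (B u) i \<ge> \<sigma>\<close>, then the inverse \<open>N\<close> of \<open>I - B\<close> exists and is nonnegative by a
  maximum principle. From \<open>N (u - B u) = u\<close> one bounds the columns of \<open>N\<close> at slack rows, and
  \<open>N \<ge> N B\<close> carries the bound back along simple paths to all columns.

  For \<open>q < 1\<close> take \<open>u = 1 - q\<close>: rows \<open>x\<^sub>j x\<^sub>k\<close> have slack because \<open>y < 1\<close>, linear rows have slack if
  their coefficients sum to less than \<open>1\<close>, and such rows are reached since otherwise \<open>q\<close> would not be
  least. This needs a lower bound on \<open>1 - q\<close>, which propagates along edges from a bottom strongly
  connected component. There \<open>v = 1 - q\<close> satisfies \<open>(P'(1) - I) v = Q(v)\<close> with \<open>Q\<close> quadratic;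
  eliminating a maximal set of rows \<open>T\<close> for which \<open>I - P'(1)\<^sub>T\<close> is an M-matrix leaves a row with
  nonnegative coefficients, one of which is a positive rational of small denominator, so \<open>v\<close> cannot
  be small.

  For \<open>q = 1\<close> and a strongly connected system take \<open>u = 1 - x\<close>, where \<open>x < 1\<close> is a late iterate
  towards \<open>q\<close>; if there is no product row, \<open>u = 1\<close> works.
\<close>

section \<open>Substochastic matrices and determinants\<close>

text \<open>Cut the path at its last departure from \<open>a\<close>: what remains leaves only
  vertices of \<open>W - {a}\<close>. This removes loops without choosing a shortest path.\<close>

lemma rtrancl_avoiding_source:
  assumes "(x, b) \<in> (R \<inter> W \<times> UNIV)\<^sup>*"
  shows "(x, b) \<in> (R \<inter> (W - {a}) \<times> UNIV)\<^sup>* \<or>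
         (\<exists>y. (a, y) \<in> R \<inter> W \<times> UNIV \<and> (y, b) \<in> (R \<inter> (W - {a}) \<times> UNIV)\<^sup>*)"
  using assms
proof (induction rule: converse_rtrancl_induct)
  case base
  then show ?case by simp
next
  case (step y z)
  show ?case
  proof (cases "y = a")
    case False
    then have "(y, z) \<in> R \<inter> (W - {a}) \<times> UNIV" using step.hyps by auto
    then show ?thesis using step.IH by (meson converse_rtrancl_into_rtrancl)
  qed (use step in auto)
qed

text \<open>Along a path each source may be charged only once, because a shortest path is simple.\<close>

lemma rtrancl_weight:
  fixes l :: "'a::finite \<Rightarrow> nat" and T :: "nat \<Rightarrow> 'a \<Rightarrow> 'a \<Rightarrow> bool"
  assumes path: "(a, b) \<in> R\<^sup>*"
    and refl: "\<And>x. T 0 x x"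
    and edge: "\<And>x y. (x, y) \<in> R \<Longrightarrow> T (l x) x y"
    and trans: "\<And>m n x y z. T m x y \<Longrightarrow> T n y z \<Longrightarrow> T (m + n) x z"
    and mono: "\<And>m n x y. T m x y \<Longrightarrow> m \<le> n \<Longrightarrow> T n x y"
  shows "T (\<Sum>x\<in>UNIV. l x) a b"
proof -
  have "T (\<Sum>x\<in>W. l x) a b" if "finite W" "(a, b) \<in> (R \<inter> W \<times> UNIV)\<^sup>*" for W a
    using that
  proof (induction "card W" arbitrary: W a)
    case 0
    then have "a = b" by auto
    then show ?case using refl mono by blast
  next
    case (Suc n)
    show ?case
    proof (cases "a = b")
      case True
      then show ?thesis using refl mono by blast
    next
      case False
      have "a \<in> W" using Suc.prems(2) False by (auto elim: converse_rtranclE)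
      have "\<exists>y. (a, y) \<in> R \<and> (y, b) \<in> (R \<inter> (W - {a}) \<times> UNIV)\<^sup>*"
        using rtrancl_avoiding_source[OF Suc.prems(2), of a] False
        by (auto elim: converse_rtranclE)
      then obtain y where y: "(a, y) \<in> R" "(y, b) \<in> (R \<inter> (W - {a}) \<times> UNIV)\<^sup>*" by blast
      \<comment> \<open>\<open>W\<close> holds the sources not yet charged; \<open>a\<close> pays
        \<open>l a\<close> once and is then removed.\<close>
      have "n = card (W - {a})" using Suc.hyps(2) \<open>a \<in> W\<close> Suc.prems(1) by simp
      then have "T (\<Sum>x\<in>W - {a}. l x) y b" using Suc.hyps(1) y(2) Suc.prems(1) by blast
      then have "T (l a + (\<Sum>x\<in>W - {a}. l x)) a b" using edge[OF y(1)] trans by blast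
      then show ?thesis using \<open>a \<in> W\<close> Suc.prems(1) by (simp add: sum.remove)
    qed
  qed
  moreover have "R \<inter> UNIV \<times> UNIV = R" by auto
  ultimately show ?thesis using path by (metis finite_UNIV finite)
qed

lemma matrix_vector_mult_row: "(B *v x) $ i = (\<Sum>j\<in>UNIV. B $ i $ j * x $ j)"
  by (simp add: matrix_vector_mult_def)

lemma matrix_vector_mult_nonneg:
  fixes B :: "real^'n::finite^'m::finite"
  assumes "nonneg_matrix B" "\<And>i. 0 \<le> x $ i"
  shows "0 \<le> (B *v x) $ i"
  using assms by (auto simp: matrix_vector_mult_row nonneg_matrix_def intro!: sum_nonneg)

lemma matrix_vector_mult_ge_term:
  fixes B :: "real^'n::finite^'m::finite"
  assumes "nonneg_matrix B" "\<And>i. 0 \<le> x $ i"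
  shows "B $ i $ j * x $ j \<le> (B *v x) $ i"
  unfolding matrix_vector_mult_row
  by (rule member_le_sum) (use assms in \<open>auto simp: nonneg_matrix_def\<close>)

text \<open>Maximum principle: where \<open>x i / u i\<close> attains a negative minimum, the minimum propagates
  along the support of \<open>B\<close> until it meets a row with slack.\<close>

lemma substochastic_monotone:
  fixes B :: "real^'n::finite^'n"
  assumes B: "nonneg_matrix B"
    and u: "vec_less 0 u"
    and Bu: "\<And>i. (B *v u) $ i \<le> u $ i"
    and reach: "\<And>j. \<exists>i. (j, i) \<in> {(x, y). 0 < B $ x $ y}\<^sup>* \<and> (B *v u) $ i < u $ i"
    and x: "\<And>i. (B *v x) $ i \<le> x $ i"
  shows "0 \<le> x $ i"
proof (rule ccontr)
  assume neg: "\<not> 0 \<le> x $ i"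
  have u0: "0 < u $ k" for k using u by (simp add: vec_less_def)
  define m where "m = (MIN k. x $ k / u $ k)"
  have m_le: "m \<le> x $ k / u $ k" for k unfolding m_def by (intro Min_le) auto
  have "m \<in> range (\<lambda>k. x $ k / u $ k)" unfolding m_def by (intro Min_in) auto
  then obtain k0 where k0: "m = x $ k0 / u $ k0" by auto
  have "x $ i / u $ i < 0" using neg u0[of i] by (simp add: divide_neg_pos)
  then have m0: "m < 0" using m_le[of i] by linarith
  \<comment> \<open>\<open>z\<close> is nonnegative with zeros exactly where the minimal ratio
    \<open>m\<close> is attained. As \<open>m < 0\<close>, such a row has \<open>B z <= 0\<close>,
    and even \<open>B z < 0\<close> if \<open>u\<close> has slack there.\<close>
  define z where "z = x - m *\<^sub>R u"
  have z0: "0 \<le> z $ k" for k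
    using m_le[of k] u0[of k] by (simp add: z_def field_simps)
  have Bz: "(B *v z) $ k = (B *v x) $ k - m * (B *v u) $ k" for k
    by (simp add: z_def matrix_vector_mult_diff_distrib matrix_vector_mult_scaleR)
  have zero: "(B *v z) $ k \<le> 0" if "z $ k = 0" for k
  proof -
    have "m * u $ k \<le> m * (B *v u) $ k" using Bu[of k] m0 by (simp add: mult_left_mono_neg)
    then show ?thesis using that x[of k] Bz[of k] by (simp add: z_def)
  qed
  have step: "z $ l = 0" if "z $ k = 0" "0 < B $ k $ l" for k l
  proof -
    have "B $ k $ l * z $ l \<le> 0"
      using matrix_vector_mult_ge_term[OF B z0, of k l] zero[OF that(1)] by linarith
    then show ?thesis using that(2) z0[of l] by (simp add: mult_le_0_iff)
  qed
  obtain s where s: "(k0, s) \<in> {(x, y). 0 < B $ x $ y}\<^sup>*" "(B *v u) $ s < u $ s"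
    using reach by blast
  have "z $ k0 = 0" using k0 u0[of k0] by (simp add: z_def)
  with s(1) have "z $ s = 0" by (induction rule: rtrancl_induct) (use step in blast)+
  have "m * u $ s < m * (B *v u) $ s" using s(2) m0 by simp
  then have "(B *v z) $ s < 0" using \<open>z $ s = 0\<close> x[of s] Bz[of s] by (simp add: z_def)
  then show False using matrix_vector_mult_nonneg[OF B z0, of s] by linarith
qed

lemma matrix_inv_left: "invertible A \<Longrightarrow> matrix_inv A ** A = mat 1"
  and matrix_inv_right: "invertible A \<Longrightarrow> A ** matrix_inv A = mat 1"
  for A :: "real^'n::finite^'n"
proof -
  assume "invertible A"
  then have "\<exists>N. A ** N = mat 1 \<and> N ** A = mat 1" by (simp add: invertible_def)
  then have *: "A ** matrix_inv A = mat 1 \<and> matrix_inv A ** A = mat 1"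
    unfolding matrix_inv_def by (rule someI_ex)
  show "matrix_inv A ** A = mat 1" "A ** matrix_inv A = mat 1" using * by auto
qed

lemma one_minus_matrix_mult: "((mat 1 - B) *v x) = x - (B :: real^'n::finite^'n) *v x"
  by (simp add: matrix_vector_mult_diff_rdistrib)

text \<open>Both claims come from \<open>substochastic_monotone\<close>: a kernel vector and its
  negative are nonnegative, and column \<open>j\<close> of the inverse solves
  \<open>x - B x = axis j 1\<close>, whose right-hand side is nonnegative.\<close>

lemma substochastic_inverse:
  fixes B :: "real^'n::finite^'n"
  assumes B: "nonneg_matrix B"
    and u: "vec_less 0 u"
    and Bu: "\<And>i. (B *v u) $ i \<le> u $ i"
    and reach: "\<And>j. \<exists>i. (j, i) \<in> {(x, y). 0 < B $ x $ y}\<^sup>* \<and> (B *v u) $ i < u $ i"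
  shows "invertible (mat 1 - B)" "nonneg_matrix (matrix_inv (mat 1 - B))"
proof -
  note mono = substochastic_monotone[OF B u Bu reach]
  have "x = 0" if "(mat 1 - B) *v x = 0" for x
  proof -
    have 1: "B *v x = x" using that by (simp add: one_minus_matrix_mult)
    then have 2: "B *v (- x) = - x" using matrix_vector_mult_diff_distrib[of B 0 x] by simp
    have "0 \<le> x $ i" "0 \<le> (- x) $ i" for i
      by (rule mono, simp only: 1 order_refl) (rule mono, simp only: 2 order_refl)
    then show ?thesis by (simp add: vec_eq_iff order_antisym)
  qed
  then show inv: "invertible (mat 1 - B)"
    by (simp add: invertible_left_inverse matrix_left_invertible_ker)
  show "nonneg_matrix (matrix_inv (mat 1 - B))"
    unfolding nonneg_matrix_def
  proof (intro allI)
    fix i j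
    define x where "x = matrix_inv (mat 1 - B) *v axis j 1"
    have "(mat 1 - B) *v x = axis j 1"
      using inv by (simp add: x_def matrix_vector_mul_assoc matrix_inv_right)
    then have "x - B *v x = axis j 1" by (simp add: one_minus_matrix_mult)
    then have eq: "x $ k - (B *v x) $ k = axis j 1 $ k" for k by (metis vector_minus_component)
    have "(B *v x) $ k \<le> x $ k" for k
      using eq[of k] by (simp add: axis_def split: if_splits)
    then have "0 \<le> x $ i" by (rule mono)
    then show "0 \<le> matrix_inv (mat 1 - B) $ i $ j"
      by (simp add: x_def matrix_vector_mult_basis column_def)
  qed
qed

text \<open>Multiplying out \<open>N (I - B) = I\<close> gives \<open>N = I + N B\<close> with
  nonnegative summands only, so each summand is a lower bound.\<close>

lemma inverse_ge_mult:
  fixes B :: "real^'n::finite^'n"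
  assumes B: "nonneg_matrix B" and inv: "invertible (mat 1 - B)"
    and N: "nonneg_matrix (matrix_inv (mat 1 - B))"
  shows "matrix_inv (mat 1 - B) $ i $ j * B $ j $ k \<le> matrix_inv (mat 1 - B) $ i $ k"
    and "mat 1 $ i $ k \<le> matrix_inv (mat 1 - B) $ i $ k"
proof -
  let ?N = "matrix_inv (mat 1 - B)"
  have "(M ** (mat 1 - B)) $ i $ k = M $ i $ k - (\<Sum>m\<in>UNIV. M $ i $ m * B $ m $ k)"
    for M :: "real^'n^'n"
  proof -
    have "(M ** (mat 1 - B)) $ i $ k = (M ** mat 1) $ i $ k - (\<Sum>m\<in>UNIV. M $ i $ m * B $ m $ k)"
      by (simp add: matrix_matrix_mult_def right_diff_distrib sum_subtractf)
    then show ?thesis by (simp only: matrix_mul_rid)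
  qed
  from this[of ?N] have "?N $ i $ k = mat 1 $ i $ k + (\<Sum>m\<in>UNIV. ?N $ i $ m * B $ m $ k)"
    unfolding matrix_inv_left[OF inv] by linarith
  moreover have "?N $ i $ j * B $ j $ k \<le> (\<Sum>m\<in>UNIV. ?N $ i $ m * B $ m $ k)"
    by (rule member_le_sum) (use B N in \<open>auto simp: nonneg_matrix_def\<close>)
  moreover have "0 \<le> ?N $ i $ j * B $ j $ k" using B N by (simp add: nonneg_matrix_def)
  moreover have "(0::real) \<le> mat 1 $ i $ k" by (simp add: mat_def)
  ultimately show "?N $ i $ j * B $ j $ k \<le> ?N $ i $ k" "mat 1 $ i $ k \<le> ?N $ i $ k"
    by linarith+
qed

text \<open>The entries of a row are bounded separately, whence the factor \<open>CARD('n)\<close>.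
  The weight \<open>2 ^ l x\<close> limits how small an edge out of \<open>x\<close> may be, and the
  sum of all \<open>l\<close> suffices because a simple path leaves each vertex at most
  once.\<close>

lemma substochastic_inverse_bound:
  fixes B :: "real^'n::finite^'n" and l :: "'n \<Rightarrow> nat"
  assumes B: "nonneg_matrix B"
    and u: "vec_less 0 u" and umax: "\<And>i. u $ i \<le> M"
    and Bu: "\<And>i. (B *v u) $ i \<le> u $ i"
    and edge: "\<And>x y. (x, y) \<in> R \<Longrightarrow> 1 \<le> 2 ^ l x * B $ x $ y"
    and sigma: "0 < \<sigma>"
    and reach: "\<And>j. \<exists>i. (j, i) \<in> R\<^sup>* \<and> \<sigma> \<le> u $ i - (B *v u) $ i"
  shows "invertible (mat 1 - B)" "nonneg_matrix (matrix_inv (mat 1 - B))"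
    "matrix_norm_inf (matrix_inv (mat 1 - B)) \<le> real CARD('n) * (2 ^ (\<Sum>i\<in>UNIV. l i) * M / \<sigma>)"
proof -
  let ?N = "matrix_inv (mat 1 - B)"
  have "0 < B $ x $ y" if "(x, y) \<in> R" for x y
  proof -
    have "0 < 2 ^ l x * B $ x $ y" using edge[OF that] by linarith
    then show ?thesis by (rule zero_less_mult_pos) simp
  qed
  then have sub: "R\<^sup>* \<subseteq> {(x, y). 0 < B $ x $ y}\<^sup>*" by (intro rtrancl_mono) auto
  have reach': "\<exists>i. (j, i) \<in> {(x, y). 0 < B $ x $ y}\<^sup>* \<and> (B *v u) $ i < u $ i" for j
  proof -
    obtain i where "(j, i) \<in> R\<^sup>*" "\<sigma> \<le> u $ i - (B *v u) $ i" using reach by blast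
    then have "(j, i) \<in> {(x, y). 0 < B $ x $ y}\<^sup>*" "(B *v u) $ i < u $ i" using sub sigma by auto
    then show ?thesis by blast
  qed
  show inv: "invertible (mat 1 - B)" and N: "nonneg_matrix ?N"
    using substochastic_inverse[OF B u Bu reach'] by auto
  have N0: "0 \<le> ?N $ i $ j" for i j using N by (simp add: nonneg_matrix_def)
  \<comment> \<open>A row of the inverse weighted by the slacks sums to an entry of
    \<open>u\<close>, so at a column with slack at least \<open>\<sigma>\<close> it is at most
    \<open>M / \<sigma>\<close>.\<close>
  have Nr: "?N *v (u - B *v u) = u"
    using matrix_inv_left[OF inv]
    by (simp only: one_minus_matrix_mult[symmetric] matrix_vector_mul_assoc matrix_vector_mul_lid)
  have entry: "?N $ j $ k \<le> 2 ^ (\<Sum>i\<in>UNIV. l i) * M / \<sigma>" for j k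
  proof -
    obtain i where i: "(k, i) \<in> R\<^sup>*" "\<sigma> \<le> u $ i - (B *v u) $ i" using reach by blast
    have "?N $ j $ k \<le> 2 ^ (\<Sum>i\<in>UNIV. l i) * ?N $ j $ i"
    proof (rule rtrancl_weight[OF i(1), where T = "\<lambda>m x y. ?N $ j $ x \<le> 2 ^ m * ?N $ j $ y"])
      fix x y assume "(x, y) \<in> R"
      then have "?N $ j $ x * 1 \<le> ?N $ j $ x * (2 ^ l x * B $ x $ y)"
        by (intro mult_left_mono edge N0)
      also have "\<dots> \<le> 2 ^ l x * ?N $ j $ y"
        using inverse_ge_mult(1)[OF B inv N, of j x y] by (simp add: algebra_simps)
      finally show "?N $ j $ x \<le> 2 ^ l x * ?N $ j $ y" by simp
    next
      fix m n x y z assume "?N $ j $ x \<le> 2 ^ m * ?N $ j $ y" "?N $ j $ y \<le> 2 ^ n * ?N $ j $ z"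
      then have "?N $ j $ x \<le> 2 ^ m * (2 ^ n * ?N $ j $ z)"
        by (meson mult_left_mono order_trans zero_le_numeral zero_le_power)
      then show "?N $ j $ x \<le> 2 ^ (m + n) * ?N $ j $ z" by (simp add: power_add)
    next
      fix m n :: nat and x y assume "?N $ j $ x \<le> 2 ^ m * ?N $ j $ y" "m \<le> n"
      moreover have "2 ^ m * ?N $ j $ y \<le> 2 ^ n * ?N $ j $ y"
        by (intro mult_right_mono power_increasing N0) (use \<open>m \<le> n\<close> in auto)
      ultimately show "?N $ j $ x \<le> 2 ^ n * ?N $ j $ y" by linarith
    qed simp
    moreover have "?N $ j $ i \<le> M / \<sigma>"
    proof -
      have "?N $ j $ i * \<sigma> \<le> ?N $ j $ i * (u - B *v u) $ i"
        using i(2) N0 by (simp add: mult_left_mono)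
      also have "\<dots> \<le> (?N *v (u - B *v u)) $ j"
        using N Bu by (intro matrix_vector_mult_ge_term) auto
      also have "\<dots> \<le> M" using Nr umax by simp
      finally show ?thesis using sigma by (simp add: pos_le_divide_eq)
    qed
    then have "2 ^ (\<Sum>i\<in>UNIV. l i) * ?N $ j $ i \<le> 2 ^ (\<Sum>i\<in>UNIV. l i) * (M / \<sigma>)"
      by (rule mult_left_mono) simp
    ultimately show ?thesis by simp
  qed
  show "matrix_norm_inf ?N \<le> real CARD('n) * (2 ^ (\<Sum>i\<in>UNIV. l i) * M / \<sigma>)"
    unfolding matrix_norm_inf_def
  proof (intro Max.boundedI)
    fix r assume "r \<in> range (\<lambda>i. \<Sum>j\<in>UNIV. \<bar>?N $ i $ j\<bar>)"
    then obtain i where "r = (\<Sum>j\<in>UNIV. \<bar>?N $ i $ j\<bar>)" by auto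
    also have "\<dots> \<le> (\<Sum>j\<in>(UNIV::'n set). 2 ^ (\<Sum>i\<in>UNIV. l i) * M / \<sigma>)"
      using entry N0 by (intro sum_mono) auto
    finally show "r \<le> real CARD('n) * (2 ^ (\<Sum>i\<in>UNIV. l i) * M / \<sigma>)" by simp
  qed auto
qed

text \<open>In the Leibniz formula the signs drop out, and summing over all self-maps instead of
  permutations only adds nonnegative terms. The larger sum factors into row sums.\<close>

lemma abs_det_le_prod_row_sums:
  fixes A :: "real^'n::finite^'n"
  shows "\<bar>det A\<bar> \<le> (\<Prod>i\<in>UNIV. \<Sum>j\<in>UNIV. \<bar>A $ i $ j\<bar>)"
proof -
  have "\<bar>det A\<bar> \<le> (\<Sum>p\<in>{p. p permutes (UNIV::'n set)}. \<bar>of_int (sign p) * (\<Prod>i\<in>UNIV. A $ i $ p i)\<bar>)"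
    unfolding det_def by (rule sum_abs)
  also have "\<dots> = (\<Sum>p\<in>{p. p permutes (UNIV::'n set)}. \<Prod>i\<in>UNIV. \<bar>A $ i $ p i\<bar>)"
    by (intro sum.cong) (auto simp: abs_mult abs_prod sign_def)
  also have "\<dots> \<le> (\<Sum>p\<in>UNIV. \<Prod>i\<in>UNIV. \<bar>A $ i $ p i\<bar>)"
    by (intro sum_mono2) (auto intro!: prod_nonneg)
  also have "\<dots> = (\<Prod>i\<in>UNIV. \<Sum>j\<in>UNIV. \<bar>A $ i $ j\<bar>)"
    by (simp add: prod_sum_PiE)
  finally show ?thesis .
qed

lemma det_in_Ints:
  fixes A :: "real^'n::finite^'n"
  assumes "\<And>i j. A $ i $ j \<in> \<int>"
  shows "det A \<in> \<int>"
  unfolding det_def by (intro Ints_sum Ints_mult Ints_prod assms) auto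

section \<open>Quadratic systems in normal form\<close>

text \<open>The source of all lower bounds on coefficients: a positive rational is at least the
  reciprocal of its denominator.\<close>

lemma one_le_mult_of_Ints:
  fixes a b :: real
  assumes "a * b \<in> \<int>" "0 < a" "0 < b"
  shows "1 \<le> a * b"
  using Ints_nonzero_abs_ge1[OF assms(1)] assms(2,3) by simp

text \<open>The rows in \<open>L\<close> are linear, the others are the products of the variables \<open>pj i\<close> and \<open>pk i\<close>;
  \<open>den i\<close> is a common denominator of the coefficients of row \<open>i\<close>.\<close>

locale normal_form_system =
  fixes L :: "'n::finite set" and a :: "'n \<Rightarrow> 'n \<Rightarrow> real" and c :: "'n \<Rightarrow> real"
    and pj pk :: "'n \<Rightarrow> 'n" and den :: "'n \<Rightarrow> real" and len :: "'n \<Rightarrow> nat"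
  assumes a_nonneg: "i \<in> L \<Longrightarrow> 0 \<le> a i j"
    and c_nonneg: "i \<in> L \<Longrightarrow> 0 \<le> c i"
    and row_le_1: "i \<in> L \<Longrightarrow> c i + (\<Sum>j\<in>UNIV. a i j) \<le> 1"
    and den_Ints: "den i \<in> \<int>"
    and den_ge_1: "1 \<le> den i"
    and den_le: "2 * den i \<le> 2 ^ len i"
    and den_prod: "i \<notin> L \<Longrightarrow> den i = 1"
    and den_a: "i \<in> L \<Longrightarrow> den i * a i j \<in> \<int>"
    and den_c: "i \<in> L \<Longrightarrow> den i * c i \<in> \<int>"
    and len_ge_2: "2 \<le> len i"
begin

definition F :: "real^'n \<Rightarrow> real^'n" where
  "F x = (\<chi> i. if i \<in> L then c i + (\<Sum>j\<in>UNIV. a i j * x $ j) else x $ pj i * x $ pk i)"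

text \<open>For \<open>pj i = pk i\<close> the two contributions land in the same column and add up
  to the derivative of the square.\<close>

definition J :: "real^'n \<Rightarrow> real^'n^'n" where
  "J x = (\<chi> i j. if i \<in> L then a i j
     else (if j = pj i then x $ pk i else 0) + (if j = pk i then x $ pj i else 0))"

definition edges :: "('n \<times> 'n) set" where
  "edges = {(i, j). if i \<in> L then 0 < a i j else j = pj i \<or> j = pk i}"

text \<open>Edges out of product rows are left out, since their entries in \<open>J y\<close> may be
  0. Paths in the inverse bounds may end at a product row, which has slack itself.\<close>

definition linear_edges :: "('n \<times> 'n) set" where
  "linear_edges = {(i, j). i \<in> L \<and> 0 < a i j}"

definition deficient :: "'n \<Rightarrow> bool" where
  "deficient i \<longleftrightarrow> i \<in> L \<and> c i + (\<Sum>j\<in>UNIV. a i j) < 1"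

abbreviation len_sum :: nat where "len_sum \<equiv> \<Sum>i\<in>UNIV. len i"

lemma F_lin: "i \<in> L \<Longrightarrow> F x $ i = c i + (\<Sum>j\<in>UNIV. a i j * x $ j)"
  and F_prod: "i \<notin> L \<Longrightarrow> F x $ i = x $ pj i * x $ pk i"
  by (simp_all add: F_def)

lemma J_mult_lin: "i \<in> L \<Longrightarrow> (J x *v h) $ i = (\<Sum>j\<in>UNIV. a i j * h $ j)"
  by (simp add: J_def matrix_vector_mult_row)

lemma J_mult_prod: "i \<notin> L \<Longrightarrow> (J x *v h) $ i = x $ pk i * h $ pj i + x $ pj i * h $ pk i"
  by (simp add: J_def matrix_vector_mult_row distrib_right sum.distrib if_distrib[of "\<lambda>t. t * _"]
      cong: if_cong)

lemma F_has_derivative: "(F has_derivative (\<lambda>h. J x *v h)) (at x)"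
proof -
  note nth = bounded_linear_imp_has_derivative[OF bounded_linear_vec_nth]
  have "((\<lambda>y. F y $ i) has_derivative (\<lambda>h. (J x *v h) $ i)) (at x)" for i
  proof (cases "i \<in> L")
    case True
    then show ?thesis by (auto simp: F_lin J_mult_lin intro!: derivative_eq_intros nth)
  next
    case False
    then show ?thesis
      by (auto simp: F_prod J_mult_prod algebra_simps intro!: derivative_eq_intros nth)
  qed
  then show ?thesis
    by (subst has_derivative_componentwise_within)
      (auto simp: Basis_vec_def inner_axis)
qed

text \<open>Since \<open>F\<close> is quadratic, the mean value theorem is exact at the midpoint.\<close>

lemma F_diff: "F x $ i - F y $ i = (J ((1/2) *\<^sub>R (x + y)) *v (x - y)) $ i"
proof (cases "i \<in> L")
  case True
  then show ?thesis by (simp add: F_lin J_mult_lin right_diff_distrib sum_subtractf)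
next
  case False
  then show ?thesis by (simp add: F_prod J_mult_prod field_simps)
qed

lemma J_nonneg: "(\<And>i. 0 \<le> x $ i) \<Longrightarrow> nonneg_matrix (J x)"
  by (auto simp: nonneg_matrix_def J_def a_nonneg)

lemma F_mono:
  assumes "\<And>i. 0 \<le> x $ i" "\<And>i. x $ i \<le> y $ i"
  shows "F x $ i \<le> F y $ i"
proof (cases "i \<in> L")
  case True
  then show ?thesis using assms by (auto simp: F_lin a_nonneg intro!: sum_mono mult_left_mono)
next
  case False
  have "0 \<le> y $ j" for j using assms order_trans by blast
  then show ?thesis using False assms by (auto simp: F_prod intro!: mult_mono)
qed

lemma one_le_den_a: "i \<in> L \<Longrightarrow> 0 < a i j \<Longrightarrow> 1 \<le> den i * a i j"
  using one_le_mult_of_Ints[OF den_a[of i j]] den_ge_1[of i] by simp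

lemma den_le': "den i \<le> 2 ^ len i"
  using den_le[of i] den_ge_1[of i] by linarith

lemma len_le_len_sum: "len i \<le> len_sum"
  by (rule member_le_sum) auto

lemma card_le_len_sum: "2 * CARD('n) \<le> len_sum"
  using sum_mono[of "UNIV :: 'n set" "\<lambda>_. 2" len] len_ge_2 by simp

lemma card_le_pow_len_sum: "real CARD('n) \<le> 2 ^ len_sum"
proof -
  have "CARD('n) \<le> len_sum" using card_le_len_sum by linarith
  also have "\<dots> < 2 ^ len_sum" by (rule less_exp)
  finally show ?thesis by (metis less_imp_le of_nat_le_iff of_nat_numeral of_nat_power)
qed

lemma len_sum_ge_2: "2 \<le> len_sum"
  using len_le_len_sum len_ge_2 order_trans by blast

text \<open>Multiplied by \<open>den i\<close>, the slack of a deficient row becomes a positive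
  integer.\<close>

lemma deficient_ge: "deficient i \<Longrightarrow> 1 \<le> 2 ^ len_sum * (1 - c i - (\<Sum>j\<in>UNIV. a i j))"
proof -
  assume i: "deficient i"
  then have iL: "i \<in> L" and less: "0 < 1 - c i - (\<Sum>j\<in>UNIV. a i j)"
    by (auto simp: deficient_def)
  have "den i * (1 - c i - (\<Sum>j\<in>UNIV. a i j)) = den i - den i * c i - (\<Sum>j\<in>UNIV. den i * a i j)"
    by (simp add: right_diff_distrib sum_distrib_left)
  also have "\<dots> \<in> \<int>" using iL den_Ints den_a den_c by (intro Ints_diff Ints_sum) auto
  finally have "1 \<le> den i * (1 - c i - (\<Sum>j\<in>UNIV. a i j))"
    using less den_ge_1[of i] by (intro one_le_mult_of_Ints) auto
  also have "\<dots> \<le> 2 ^ len_sum * (1 - c i - (\<Sum>j\<in>UNIV. a i j))"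
  proof (intro mult_right_mono)
    have "den i \<le> 2 ^ len i" by (rule den_le')
    also have "\<dots> \<le> 2 ^ len_sum" by (intro power_increasing len_le_len_sum) simp
    finally show "den i \<le> 2 ^ len_sum" .
  qed (use less in simp)
  finally show ?thesis .
qed

lemma const_ge: "i \<in> L \<Longrightarrow> 0 < c i \<Longrightarrow> 1 \<le> 2 ^ len_sum * c i"
proof -
  assume iL: "i \<in> L" and ci: "0 < c i"
  have "1 \<le> den i * c i" using one_le_mult_of_Ints[OF den_c[OF iL]] den_ge_1[of i] ci by simp
  also have "\<dots> \<le> 2 ^ len_sum * c i"
  proof (intro mult_right_mono)
    have "den i \<le> 2 ^ len i" by (rule den_le')
    also have "\<dots> \<le> 2 ^ len_sum" by (intro power_increasing len_le_len_sum) simp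
    finally show "den i \<le> 2 ^ len_sum" .
  qed (use ci in simp)
  finally show ?thesis .
qed

text \<open>A factor \<open>1/2\<close> is allowed in the product rows, so that this applies to both
  \<open>F q = q\<close> and to midpoint Jacobians.\<close>

lemma path_le:
  assumes u: "\<And>i. 0 \<le> u $ i"
    and lin: "\<And>i. i \<in> L \<Longrightarrow> (\<Sum>j\<in>UNIV. a i j * u $ j) \<le> u $ i"
    and prod: "\<And>i. i \<notin> L \<Longrightarrow> u $ pj i \<le> 2 * u $ i \<and> u $ pk i \<le> 2 * u $ i"
    and path: "(x, y) \<in> edges\<^sup>*"
  shows "u $ y \<le> 2 ^ len_sum * u $ x"
proof (rule rtrancl_weight[OF path, where T = "\<lambda>m x y. u $ y \<le> 2 ^ m * u $ x"])
  fix i j assume ij: "(i, j) \<in> edges"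
  show "u $ j \<le> 2 ^ len i * u $ i"
  proof (cases "i \<in> L")
    case True
    then have "0 < a i j" using ij by (simp add: edges_def)
    have "1 * u $ j \<le> (den i * a i j) * u $ j"
      using one_le_den_a[OF True \<open>0 < a i j\<close>] u by (intro mult_right_mono) auto
    also have "\<dots> \<le> den i * (\<Sum>j\<in>UNIV. a i j * u $ j)"
      using a_nonneg[OF True] u den_ge_1[of i] member_le_sum[of j UNIV "\<lambda>j. a i j * u $ j"]
      by (simp add: mult.assoc)
    also have "\<dots> \<le> den i * u $ i" using lin[OF True] den_ge_1[of i] by (intro mult_left_mono) auto
    also have "\<dots> \<le> 2 ^ len i * u $ i" using den_le' u by (intro mult_right_mono) auto
    finally show ?thesis by simp
  next
    case False
    then have "u $ j \<le> 2 ^ 1 * u $ i" using ij prod by (auto simp: edges_def)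
    also have "\<dots> \<le> 2 ^ len i * u $ i"
      using len_ge_2[of i] u by (intro mult_right_mono power_increasing) auto
    finally show ?thesis .
  qed
next
  fix m n x y z assume "u $ y \<le> 2 ^ m * u $ x" and *: "u $ z \<le> 2 ^ n * u $ y"
  then have "2 ^ n * u $ y \<le> 2 ^ n * (2 ^ m * u $ x)" by (intro mult_left_mono) auto
  with * have "u $ z \<le> 2 ^ n * (2 ^ m * u $ x)" by (rule order_trans)
  then show "u $ z \<le> 2 ^ (m + n) * u $ x" by (simp add: power_add mult_ac)
next
  fix m n :: nat and x y assume *: "u $ y \<le> 2 ^ m * u $ x" "m \<le> n"
  then have "2 ^ m * u $ x \<le> 2 ^ n * u $ x"
    using u by (intro mult_right_mono power_increasing) auto
  then show "u $ y \<le> 2 ^ n * u $ x" using * by linarith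
qed simp

text \<open>Linear rows of \<open>J\<close> do not depend on the point, so the bound is uniform in
  \<open>x\<close>.\<close>

lemma linear_edge_weight: "(i, j) \<in> linear_edges \<Longrightarrow> 1 \<le> 2 ^ len i * J x $ i $ j"
proof -
  assume "(i, j) \<in> linear_edges"
  then have ij: "i \<in> L" "0 < a i j" by (auto simp: linear_edges_def)
  have "1 \<le> den i * a i j" using one_le_den_a ij by blast
  also have "\<dots> \<le> 2 ^ len i * a i j" using den_le'[of i] ij(2) by (intro mult_right_mono) auto
  finally show ?thesis using ij by (simp add: J_def)
qed

end

section \<open>The least fixed point\<close>

locale normal_form_lfp = normal_form_system L a c pj pk den len
  for L :: "'n::finite set" and a c pj pk den len +
  fixes q :: "real^'n"
  assumes q_pos: "0 < q $ i"
    and F_q: "F q = q"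
    and q_least: "(\<And>i. 0 \<le> x $ i) \<Longrightarrow> (\<And>i. x $ i \<le> 1) \<Longrightarrow> F x = x \<Longrightarrow> q $ i \<le> x $ i"
begin

text \<open>Averaging \<open>F\<close> with the identity keeps the iterates strictly below \<open>1\<close>.\<close>

definition iterate :: "nat \<Rightarrow> real^'n" where
  "iterate k = ((\<lambda>x. (1/2) *\<^sub>R (x + F x)) ^^ k) 0"

lemma iterate_0: "iterate 0 = 0"
  and iterate_Suc: "iterate (Suc k) = (1/2) *\<^sub>R (iterate k + F (iterate k))"
  by (simp_all add: iterate_def)

lemma F_nonneg: "(\<And>i. 0 \<le> x $ i) \<Longrightarrow> 0 \<le> F x $ i"
  by (auto simp: F_def a_nonneg c_nonneg intro!: add_nonneg_nonneg sum_nonneg)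

lemma iterate_nonneg: "0 \<le> iterate k $ i"
proof (induction k arbitrary: i)
  case (Suc k)
  then show ?case using F_nonneg[of "iterate k" i] by (simp add: iterate_Suc)
qed (simp add: iterate_0)

lemma iterate_le_F: "iterate k $ i \<le> F (iterate k) $ i"
proof (induction k arbitrary: i)
  case 0
  then show ?case using F_nonneg[of 0] by (simp add: iterate_0)
next
  case (Suc k)
  have "iterate k $ j \<le> iterate (Suc k) $ j" for j using Suc[of j] by (simp add: iterate_Suc)
  then have "F (iterate k) $ i \<le> F (iterate (Suc k)) $ i" by (intro F_mono iterate_nonneg)
  then show ?case using Suc[of i] by (simp add: iterate_Suc)
qed

lemma iterate_le_prefixed:
  assumes "\<And>i. 0 \<le> z $ i" "\<And>i. F z $ i \<le> z $ i"
  shows "iterate k $ i \<le> z $ i"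
proof (induction k arbitrary: i)
  case (Suc k)
  have "F (iterate k) $ i \<le> F z $ i" using Suc by (intro F_mono iterate_nonneg)
  then show ?case using Suc[of i] assms(2)[of i] by (simp add: iterate_Suc)
qed (simp add: iterate_0 assms)

lemma F_1_le: "F 1 $ i \<le> 1"
  using row_le_1[of i] by (auto simp: F_def)

lemma iterate_less_1: "iterate k $ i < 1"
proof (induction k arbitrary: i)
  case (Suc k)
  have "F (iterate k) $ i \<le> F 1 $ i"
    using Suc by (intro F_mono iterate_nonneg) (simp add: less_imp_le)
  then show ?case using Suc[of i] F_1_le[of i] by (simp add: iterate_Suc)
qed (simp add: iterate_0)

text \<open>The iterates increase and stay in the unit cube; by continuity of \<open>F\<close> the
  limit is fixed by the averaged map, hence by \<open>F\<close>.\<close>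

lemma iterate_limit:
  obtains l where "\<And>i. (\<lambda>k. iterate k $ i) \<longlonglongrightarrow> l $ i" "F l = l"
proof -
  have "convergent (\<lambda>k. iterate k $ i)" for i
  proof (rule Bseq_monoseq_convergent)
    show "Bseq (\<lambda>k. iterate k $ i)"
      using iterate_nonneg iterate_less_1[THEN less_imp_le] by (intro BseqI'[of _ 1]) simp
    show "monoseq (\<lambda>k. iterate k $ i)"
      using iterate_le_F by (intro mono_SucI1) (simp add: iterate_Suc field_simps)
  qed
  then have "\<exists>r. \<forall>i. (\<lambda>k. iterate k $ i) \<longlonglongrightarrow> r i"
    unfolding convergent_def by (rule choice[OF allI])
  then obtain r where r: "\<And>i. (\<lambda>k. iterate k $ i) \<longlonglongrightarrow> r i" by blast
  define l where "l = (\<chi> i. r i)"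
  have l: "(\<lambda>k. iterate k $ i) \<longlonglongrightarrow> l $ i" for i using r by (simp add: l_def)
  then have lim: "iterate \<longlonglongrightarrow> l" by (rule vec_tendstoI)
  have "isCont F l" using F_has_derivative by (rule has_derivative_continuous)
  then have "(\<lambda>k. F (iterate k)) \<longlonglongrightarrow> F l" using lim by (rule isCont_tendsto_compose)
  then have "(\<lambda>k. iterate (Suc k)) \<longlonglongrightarrow> (1/2) *\<^sub>R (l + F l)"
    unfolding iterate_Suc using lim by (intro tendsto_intros)
  moreover have "(\<lambda>k. iterate (Suc k)) \<longlonglongrightarrow> l" using lim by (rule LIMSEQ_Suc)
  ultimately have mid: "(1/2) *\<^sub>R (l + F l) = l" by (rule LIMSEQ_unique)
  have "F l $ i = l $ i" for i
    using arg_cong[OF mid, of "\<lambda>x. x $ i"] by simp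
  then have "F l = l" by (simp add: vec_eq_iff)
  with l show ?thesis by (rule that)
qed

text \<open>The limit is a fixed point in the unit cube, so leastness bounds it below by
  \<open>q\<close>; conversely \<open>q\<close> is prefixed and bounds every iterate.\<close>

lemma iterate_tendsto: "(\<lambda>k. iterate k $ i) \<longlonglongrightarrow> q $ i"
proof -
  obtain l where l: "\<And>i. (\<lambda>k. iterate k $ i) \<longlonglongrightarrow> l $ i" "F l = l"
    by (rule iterate_limit) blast
  have "0 \<le> l $ i" "l $ i \<le> 1" for i
    using l(1)[of i] iterate_nonneg iterate_less_1[THEN less_imp_le]
    by (auto intro: LIMSEQ_le_const LIMSEQ_le_const2)
  then have "q $ i \<le> l $ i" using l(2) by (intro q_least)
  moreover have "l $ i \<le> q $ i"
    using iterate_le_prefixed[of q] q_pos F_q l(1)[of i]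
    by (intro LIMSEQ_le_const2[OF l(1)]) (auto simp: less_imp_le)
  ultimately show ?thesis using l(1)[of i] by simp
qed

text \<open>Leastness among fixed points in the cube is upgraded to leastness among all nonnegative
  prefixed points, which turns a downward perturbation of \<open>q\<close> into a
  contradiction.\<close>

lemma q_le_prefixed:
  assumes "\<And>i. 0 \<le> z $ i" "\<And>i. F z $ i \<le> z $ i"
  shows "q $ i \<le> z $ i"
  by (rule LIMSEQ_le_const2[OF iterate_tendsto]) (use iterate_le_prefixed[OF assms] in blast)

text \<open>On a set \<open>C\<close> of rows that never meets slack \<open>F\<close> is affine and fixes both \<open>q\<close> and \<open>1\<close>, so
  moving \<open>q\<close> away from \<open>1\<close> on \<open>C\<close> gives a smaller prefixed point.\<close>

lemma reaches_slack:
  assumes q1: "\<And>i. q $ i < 1"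
  shows "\<exists>i. (j, i) \<in> linear_edges\<^sup>* \<and> (i \<notin> L \<or> deficient i)"
proof (rule ccontr)
  define C where "C = {j. \<not> (\<exists>i. (j, i) \<in> linear_edges\<^sup>* \<and> (i \<notin> L \<or> deficient i))}"
  assume "\<not> ?thesis"
  then have jC: "j \<in> C" by (simp add: C_def)
  have CL: "i \<in> L" "\<not> deficient i" if "i \<in> C" for i using that by (auto simp: C_def)
  have closed: "k \<in> C" if "i \<in> C" "0 < a i k" for i k
  proof -
    have "(i, k) \<in> linear_edges" using that CL by (simp add: linear_edges_def)
    then show ?thesis using that(1) unfolding C_def
      by (blast intro: converse_rtrancl_into_rtrancl)
  qed
  \<comment> \<open>The step size: since \<open>1 - q <= 1\<close>, subtracting
    \<open>t * (1 - q)\<close> with \<open>t\<close> the least entry of \<open>q\<close> keeps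
    \<open>z\<close> nonnegative.\<close>
  define t where "t = (MIN i. q $ i)"
  have t_le: "t \<le> q $ i" for i unfolding t_def by (intro Min_le) auto
  have "t \<in> range (\<lambda>i. q $ i)" unfolding t_def by (intro Min_in) auto
  then have t0: "0 < t" using q_pos by auto
  define z where "z = (\<chi> i. if i \<in> C then q $ i - t * (1 - q $ i) else q $ i)"
  have zq: "z $ i \<le> q $ i" for i using q1[of i] t0 by (simp add: z_def)
  have z0: "0 \<le> z $ i" for i
  proof -
    have "t * (1 - q $ i) \<le> t * 1" using t0 q_pos[of i] by (intro mult_left_mono) auto
    then show ?thesis using t_le[of i] q_pos[of i] by (simp add: z_def)
  qed
  have "F z $ i \<le> z $ i" for i
  proof (cases "i \<in> C")
    case False
    then show ?thesis using F_mono[OF z0 zq, of i] F_q by (simp add: z_def)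
  next
    case True
    then have iL: "i \<in> L" and full: "c i + (\<Sum>j\<in>UNIV. a i j) = 1"
      using CL row_le_1[of i] by (auto simp: deficient_def order_le_less)
    have "a i k * z $ k = a i k * q $ k - t * (a i k - a i k * q $ k)" for k
    proof (cases "0 < a i k")
      case 1: True
      then show ?thesis using closed[OF True 1] by (simp add: z_def algebra_simps)
    next
      case False
      then have "a i k = 0" using a_nonneg[OF iL, of k] by simp
      then show ?thesis by simp
    qed
    then have "F z $ i = c i + (\<Sum>k\<in>UNIV. a i k * q $ k)
        - t * ((\<Sum>k\<in>UNIV. a i k) - (\<Sum>k\<in>UNIV. a i k * q $ k))"
      using iL by (simp add: F_lin sum_subtractf sum_distrib_left right_diff_distrib)
    moreover have "q $ i = c i + (\<Sum>k\<in>UNIV. a i k * q $ k)" using F_lin[OF iL, of q] F_q by simp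
    moreover have "(\<Sum>k\<in>UNIV. a i k) - (\<Sum>k\<in>UNIV. a i k * q $ k) = 1 - q $ i"
      using full calculation(2) by linarith
    ultimately show ?thesis using True by (simp add: z_def)
  qed
  then have "q $ j \<le> z $ j" using z0 by (intro q_le_prefixed)
  moreover have "z $ j < q $ j" using jC t0 q1[of j] by (simp add: z_def)
  ultimately show False by simp
qed

end

section \<open>Subcritical sets of rows\<close>

lemma power_two_sum_mono:
  "(\<Sum>i\<in>X. f i) \<le> (\<Sum>i\<in>Y. f i :: nat) \<Longrightarrow> (2::real) ^ (\<Sum>i\<in>X. f i) \<le> 2 ^ (\<Sum>i\<in>Y. f i)"
  by (rule power_increasing) auto

context normal_form_lfp
begin

text \<open>Rows outside \<open>T\<close> are set to zero rather than deleted, which keeps the index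
  type; there \<open>I - restricted T\<close> agrees with the identity.\<close>

definition restricted :: "'n set \<Rightarrow> real^'n^'n" where
  "restricted T = (\<chi> i j. if i \<in> T then J 1 $ i $ j else 0)"

text \<open>For a nonnegative matrix such a \<open>w\<close> characterises spectral radius below 1,
  so \<open>I - restricted T\<close> is a nonsingular M-matrix.\<close>

definition subcritical :: "'n set \<Rightarrow> bool" where
  "subcritical T \<longleftrightarrow> (\<exists>w. vec_less 0 w \<and> vec_less (restricted T *v w) w)"

definition resolvent :: "'n set \<Rightarrow> real^'n^'n" where
  "resolvent T = matrix_inv (mat 1 - restricted T)"

lemma J_1_nonneg: "0 \<le> J 1 $ i $ j"
  using J_nonneg[of 1] by (simp add: nonneg_matrix_def)

lemma J_1_row_sum: "(\<Sum>j\<in>UNIV. J 1 $ i $ j) \<le> (if i \<in> L then 1 else 2)"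
  using row_le_1[of i] c_nonneg[of i] by (cases "i \<in> L") (simp_all add: J_def sum.distrib)

lemma restricted_mult_in: "i \<in> T \<Longrightarrow> (restricted T *v x) $ i = (J 1 *v x) $ i"
  and restricted_mult_notin: "i \<notin> T \<Longrightarrow> (restricted T *v x) $ i = 0"
  by (simp_all add: restricted_def matrix_vector_mult_row)

lemma restricted_nonneg: "nonneg_matrix (restricted T)"
  by (simp add: nonneg_matrix_def restricted_def J_1_nonneg)

lemma subcritical_inverse:
  assumes "subcritical T"
  shows "invertible (mat 1 - restricted T)" "nonneg_matrix (resolvent T)"
proof -
  obtain w where w: "vec_less 0 w" "vec_less (restricted T *v w) w"
    using assms by (auto simp: subcritical_def)
  \<comment> \<open>Every row has strict slack, so the empty path suffices.\<close>
  have "\<exists>i. (j, i) \<in> {(x, y). 0 < restricted T $ x $ y}\<^sup>* \<and> (restricted T *v w) $ i < w $ i" for j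
    using w(2) by (auto simp: vec_less_def)
  then show "invertible (mat 1 - restricted T)" "nonneg_matrix (resolvent T)"
    unfolding resolvent_def using w
    by (auto intro!: substochastic_inverse[OF restricted_nonneg w(1)] simp: vec_less_def less_imp_le)
qed

lemma resolvent_left:
  assumes "subcritical T"
  shows "resolvent T *v (x - restricted T *v x) = x"
proof -
  have "resolvent T *v ((mat 1 - restricted T) *v x) = x"
    unfolding resolvent_def matrix_vector_mul_assoc matrix_inv_left[OF subcritical_inverse(1)[OF assms]]
    by (rule matrix_vector_mul_lid)
  then show ?thesis unfolding one_minus_matrix_mult .
qed

lemma resolvent_right:
  assumes "subcritical T"
  shows "(resolvent T *v x) $ i - (restricted T *v (resolvent T *v x)) $ i = x $ i"
proof -
  have "(mat 1 - restricted T) *v (resolvent T *v x) = x"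
    unfolding resolvent_def matrix_vector_mul_assoc matrix_inv_right[OF subcritical_inverse(1)[OF assms]]
    by (rule matrix_vector_mul_lid)
  then show ?thesis unfolding one_minus_matrix_mult vector_minus_component[symmetric] by (rule arg_cong)
qed

lemma
  assumes "subcritical T"
  shows resolvent_nonneg: "0 \<le> resolvent T $ i $ j"
    and resolvent_ge_1: "1 \<le> resolvent T $ i $ i"
    and resolvent_step: "resolvent T $ i $ j * restricted T $ j $ k \<le> resolvent T $ i $ k"
proof -
  note inv = subcritical_inverse[OF assms, unfolded resolvent_def]
  show "0 \<le> resolvent T $ i $ j" using inv(2) by (simp add: resolvent_def nonneg_matrix_def)
  have "mat 1 $ i $ i \<le> resolvent T $ i $ i"
    unfolding resolvent_def by (rule inverse_ge_mult(2)[OF restricted_nonneg inv])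
  then show "1 \<le> resolvent T $ i $ i" by (simp add: mat_def)
  show "resolvent T $ i $ j * restricted T $ j $ k \<le> resolvent T $ i $ k"
    unfolding resolvent_def by (rule inverse_ge_mult(1)[OF restricted_nonneg inv])
qed

text \<open>The column \<open>z\<close> of the resolvent at \<open>u\<close> meets the rows of
  \<open>T\<close> with equality and row \<open>u\<close> with \<open>g < 1 = z u\<close>. Adding a
  small multiple of \<open>w\<close>, which has slack 1 in every row, makes the rows of
  \<open>T\<close> strict as well.\<close>

lemma subcritical_insert:
  assumes T: "subcritical T" and u: "u \<notin> T" and less: "(J 1 ** resolvent T) $ u $ u < 1"
  shows "subcritical (insert u T)"
proof -
  let ?N = "resolvent T"
  define z where "z = ?N *v axis u 1"
  define w where "w = ?N *v 1"
  define g where "g = (J 1 ** ?N) $ u $ u"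
  have z_eq: "z $ i - (restricted T *v z) $ i = axis u 1 $ i" for i
    unfolding z_def by (rule resolvent_right[OF T])
  have w_eq: "w $ i - (restricted T *v w) $ i = 1" for i
    unfolding w_def resolvent_right[OF T] by simp
  have N: "nonneg_matrix ?N" using subcritical_inverse[OF T] by simp
  have z0: "0 \<le> z $ i" for i
    unfolding z_def using N by (rule matrix_vector_mult_nonneg) (simp add: axis_def)
  have w0: "0 < w $ i" for i
  proof -
    have "?N $ i $ i * 1 $ i \<le> w $ i"
      unfolding w_def using N by (rule matrix_vector_mult_ge_term) simp
    then show ?thesis using resolvent_ge_1[OF T, of i] by simp
  qed
  have gz: "(J 1 *v z) $ u = g"
    unfolding z_def g_def matrix_vector_mul_assoc by (simp add: matrix_vector_mult_basis column_def)
  define b where "b = (J 1 *v w) $ u"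
  have b0: "0 \<le> b"
    unfolding b_def using w0 by (intro matrix_vector_mult_nonneg) (auto simp: J_nonneg less_imp_le)
  \<comment> \<open>With this value row \<open>u\<close> evaluates to
    \<open>g + \<epsilon> * b = 1 - \<epsilon>\<close>, while \<open>x u > 1\<close>.\<close>
  define \<epsilon> where "\<epsilon> = (1 - g) / (1 + b)"
  have e0: "0 < \<epsilon>" using less b0 by (simp add: \<epsilon>_def g_def)
  have eb: "\<epsilon> * (1 + b) = 1 - g" using b0 by (simp add: \<epsilon>_def)
  define x where "x = z + \<epsilon> *\<^sub>R w"
  have Jx: "(M *v x) $ i = (M *v z) $ i + \<epsilon> * (M *v w) $ i" for M :: "real^'n^'n" and i
    by (simp add: x_def matrix_vector_right_distrib matrix_vector_mult_scaleR)
  have xi: "x $ i = z $ i + \<epsilon> * w $ i" for i by (simp add: x_def)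
  have pos: "0 < x $ i" for i using z0[of i] w0[of i] e0 by (simp add: xi add_nonneg_pos)
  have "(restricted (insert u T) *v x) $ i < x $ i" for i
  proof (cases "i = u")
    case True
    have "z $ u = 1" using z_eq[of u] u by (simp add: restricted_mult_notin)
    moreover have "0 < \<epsilon> * w $ u" using e0 w0 by simp
    moreover have "(restricted (insert u T) *v x) $ u = g + \<epsilon> * b"
      by (simp add: restricted_mult_in Jx gz b_def)
    ultimately show ?thesis using True eb e0 by (simp add: xi distrib_left)
  next
    case iu: False
    show ?thesis
    proof (cases "i \<in> T")
      case True
      have "(restricted (insert u T) *v x) $ i = (restricted T *v x) $ i"
        using True by (simp add: restricted_mult_in)
      also have "\<dots> = z $ i + \<epsilon> * (w $ i - 1)"
        using z_eq[of i] w_eq[of i] iu by (simp add: Jx axis_def)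
      finally show ?thesis using e0 by (simp add: xi right_diff_distrib)
    next
      case False
      then show ?thesis using pos iu by (simp add: restricted_mult_notin)
    qed
  qed
  then show ?thesis using pos unfolding subcritical_def vec_less_def by auto
qed

lemma J_1_den_Ints: "den i * J 1 $ i $ j \<in> \<int>"
proof (cases "i \<in> L")
  case True
  then show ?thesis using den_a by (simp add: J_def)
next
  case False
  then show ?thesis by (simp add: J_def den_prod)
qed

text \<open>Cramer's rule for the integer matrix obtained by clearing the denominators in every row.\<close>

lemma resolvent_denominator:
  assumes T: "subcritical T"
  obtains D where "0 < D" "D \<in> \<int>" "D \<le> 2 ^ (\<Sum>i\<in>T. len i)" "\<And>i j. D * resolvent T $ i $ j \<in> \<int>"
    "\<And>i. (\<Sum>j\<in>UNIV. resolvent T $ i $ j) \<le> 2 ^ (2 * len_sum)"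
proof -
  let ?N = "resolvent T"
  \<comment> \<open>Row factors that make \<open>M\<close> integral; rows outside \<open>T\<close>
    are rows of the identity and need none.\<close>
  define s where "s i = (if i \<in> T then den i else 1)" for i
  define M where "M = (\<chi> i. s i *s (mat 1 - restricted T) $ i)"
  have s1: "1 \<le> s i" for i using den_ge_1 by (simp add: s_def)
  have M: "M $ i $ j = s i * mat 1 $ i $ j - s i * restricted T $ i $ j" for i j
    by (simp add: M_def right_diff_distrib)
  have M_Ints: "M $ i $ j \<in> \<int>" for i j
    unfolding M using den_Ints J_1_den_Ints
    by (auto simp: s_def mat_def restricted_def)
  have s_Ints: "s i \<in> \<int>" for i using den_Ints by (simp add: s_def)
  have "det M = (\<Prod>i\<in>UNIV. s i) * det (mat 1 - restricted T)"
    unfolding M_def by (simp only: det_rows_mul vec_lambda_eta)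
  moreover have "det (mat 1 - restricted T) \<noteq> 0"
    using subcritical_inverse(1)[OF T] by (simp add: invertible_det_nz)
  moreover have "(\<Prod>i\<in>UNIV. s i) \<noteq> 0" using s1 by (simp add: prod_zero_iff less_imp_neq[OF less_le_trans[OF zero_less_one], symmetric])
  ultimately have det0: "det M \<noteq> 0" by simp
  have det_Int: "det M \<in> \<int>" using M_Ints by (rule det_in_Ints)
  have det1: "1 \<le> \<bar>det M\<bar>" using Ints_nonzero_abs_ge1[OF det_Int det0] .
  have row: "(\<Sum>j\<in>UNIV. \<bar>M $ i $ j\<bar>) \<le> s i * (1 + (\<Sum>j\<in>UNIV. restricted T $ i $ j))" for i
  proof -
    have "(\<Sum>j\<in>UNIV. \<bar>M $ i $ j\<bar>) \<le> (\<Sum>j\<in>UNIV. s i * mat 1 $ i $ j + s i * restricted T $ i $ j)"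
    proof (rule sum_mono)
      fix j
      have "0 \<le> s i * mat 1 $ i $ j" "0 \<le> s i * restricted T $ i $ j"
        using s1[of i] restricted_nonneg[of T] by (auto simp: mat_def nonneg_matrix_def)
      then show "\<bar>M $ i $ j\<bar> \<le> s i * mat 1 $ i $ j + s i * restricted T $ i $ j"
        unfolding M by linarith
    qed
    also have "\<dots> = s i * (1 + (\<Sum>j\<in>UNIV. restricted T $ i $ j))"
      by (simp add: sum.distrib sum_distrib_left[symmetric] distrib_left mat_def)
    finally show ?thesis .
  qed
  have rsum: "(\<Sum>j\<in>UNIV. restricted T $ i $ j) \<le> (if i \<in> T then if i \<in> L then 1 else 2 else 0)" for i
    using J_1_row_sum[of i] by (simp add: restricted_def)
  \<comment> \<open>Here the factor 2 in \<open>den_le\<close> and \<open>2 <= len i\<close> pay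
    off: for \<open>i\<close> in \<open>T\<close> a linear row has absolute sum at most
    \<open>2 * den i\<close>, a product row at most 3. The extra \<open>s i\<close> in
    \<open>row_2\<close> covers the column replaced in Cramer's rule.\<close>
  have row_T: "(\<Sum>j\<in>UNIV. \<bar>M $ i $ j\<bar>) \<le> (if i \<in> T then 2 ^ len i else 1)"
    and row_2: "s i + (\<Sum>j\<in>UNIV. \<bar>M $ i $ j\<bar>) \<le> 2 ^ (2 * len i)" for i
  proof -
    have "(2::real) ^ 2 \<le> 2 ^ len i" using len_ge_2 by (intro power_increasing) auto
    then have p: "(4::real) \<le> 2 ^ len i" by simp
    then have "4 * 2 ^ len i \<le> (2::real) ^ len i * 2 ^ len i" by (intro mult_right_mono) auto
    then have pp: "4 * 2 ^ len i \<le> (2::real) ^ (2 * len i)" by (simp add: mult_2 power_add)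
    have "s i * (1 + (\<Sum>j\<in>UNIV. restricted T $ i $ j))
        \<le> s i * (1 + (if i \<in> T then if i \<in> L then 1 else 2 else 0))"
      using s1[of i] rsum[of i] by (intro mult_left_mono) auto
    with row[of i] have le: "(\<Sum>j\<in>UNIV. \<bar>M $ i $ j\<bar>)
        \<le> s i * (1 + (if i \<in> T then if i \<in> L then 1 else 2 else 0))" by linarith
    show "(\<Sum>j\<in>UNIV. \<bar>M $ i $ j\<bar>) \<le> (if i \<in> T then 2 ^ len i else 1)"
      using le den_le[of i] p den_prod[of i] by (auto simp: s_def split: if_splits)
    show "s i + (\<Sum>j\<in>UNIV. \<bar>M $ i $ j\<bar>) \<le> 2 ^ (2 * len i)"
      using le den_le[of i] p pp den_prod[of i] by (auto simp: s_def split: if_splits)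
  qed
  have cramer_eq: "det M * (?N *v b) $ k = det (\<chi> i j. if j = k then s i * b $ i else M $ i $ j)" for b k
  proof -
    have b: "(?N *v b) $ i - (restricted T *v (?N *v b)) $ i = b $ i" for i
      by (rule resolvent_right[OF T])
    have "(M *v (?N *v b)) $ i = s i * b $ i" for i
    proof -
      have "(M *v y) $ i = s i * ((mat 1 - restricted T) *v y) $ i" for y
        unfolding matrix_vector_mult_row sum_distrib_left
        by (intro sum.cong) (simp_all add: M left_diff_distrib right_diff_distrib mult.assoc)
      then show ?thesis unfolding one_minus_matrix_mult using b by simp
    qed
    then have "M *v (?N *v b) = (\<chi> i. s i * b $ i)" by (simp add: vec_eq_iff)
    then have "?N *v b = (\<chi> k. det (\<chi> i j. if j = k then (\<chi> i. s i * b $ i) $ i else M $ i $ j) / det M)"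
      using cramer[OF det0] by blast
    then show ?thesis using det0 by (simp cong: if_cong)
  qed
  show ?thesis
  proof (rule that)
    show "0 < \<bar>det M\<bar>" using det0 by simp
    show "\<bar>det M\<bar> \<in> \<int>" using det_Int by (rule Ints_abs)
    have "\<bar>det M\<bar> \<le> (\<Prod>i\<in>UNIV. if i \<in> T then 2 ^ len i else 1)"
      by (rule order_trans[OF abs_det_le_prod_row_sums prod_mono]) (use row_T in \<open>auto intro: sum_nonneg\<close>)
    also have "\<dots> = (\<Prod>i\<in>T. 2 ^ len i)" by (simp add: prod.If_cases)
    also have "\<dots> = 2 ^ (\<Sum>i\<in>T. len i)" by (simp add: power_sum)
    finally show "\<bar>det M\<bar> \<le> 2 ^ (\<Sum>i\<in>T. len i)" .
    fix i
    show "\<bar>det M\<bar> * ?N $ i $ j \<in> \<int>" for j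
    proof -
      have "det M * (?N *v axis j 1) $ i \<in> \<int>"
        unfolding cramer_eq using M_Ints s_Ints by (intro det_in_Ints) (auto simp: axis_def)
      then have "det M * ?N $ i $ j \<in> \<int>" by (simp add: matrix_vector_mult_basis column_def)
      then show ?thesis by (cases "0 \<le> det M") (auto simp: abs_if)
    qed
    \<comment> \<open>The row sum is the solution for right-hand side 1. As \<open>det M\<close> is
      a nonzero integer, it is at most the absolute numerator in Cramer's rule.\<close>
    have "(\<Sum>j\<in>UNIV. ?N $ i $ j) = (?N *v 1) $ i" by (simp add: matrix_vector_mult_row)
    also have "\<dots> \<le> \<bar>det M\<bar> * \<bar>(?N *v 1) $ i\<bar>"
      using det1 mult_right_mono[of 1 "\<bar>det M\<bar>" "\<bar>(?N *v 1) $ i\<bar>"] by linarith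
    also have "\<dots> = \<bar>det (\<chi> k j. if j = i then s k * 1 $ k else M $ k $ j)\<bar>"
      by (simp only: cramer_eq[symmetric] abs_mult)
    also have "\<dots> \<le> (\<Prod>k\<in>UNIV. \<Sum>j\<in>UNIV. \<bar>if j = i then s k else M $ k $ j\<bar>)"
      using abs_det_le_prod_row_sums[of "\<chi> k j. if j = i then s k * 1 $ k else M $ k $ j"]
      by (simp cong: if_cong)
    also have "\<dots> \<le> (\<Prod>k\<in>UNIV. 2 ^ (2 * len k))"
    proof (intro prod_mono conjI sum_nonneg abs_ge_zero)
      fix k
      have "(\<Sum>j\<in>UNIV. \<bar>if j = i then s k else M $ k $ j\<bar>)
          \<le> (\<Sum>j\<in>UNIV. (if j = i then s k else 0) + \<bar>M $ k $ j\<bar>)"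
        using s1[of k] by (intro sum_mono) auto
      also have "\<dots> = s k + (\<Sum>j\<in>UNIV. \<bar>M $ k $ j\<bar>)" by (simp add: sum.distrib)
      finally show "(\<Sum>j\<in>UNIV. \<bar>if j = i then s k else M $ k $ j\<bar>) \<le> 2 ^ (2 * len k)"
        using row_2[of k] by linarith
    qed
    also have "\<dots> = 2 ^ (2 * len_sum)" by (simp add: power_sum[symmetric] sum_distrib_left)
    finally show "(\<Sum>j\<in>UNIV. ?N $ i $ j) \<le> 2 ^ (2 * len_sum)" .
  qed
qed

end

section \<open>Strongly connected components\<close>

context normal_form_lfp
begin

text \<open>The quadratic part of \<open>F\<close>: expanding at 1, \<open>F 1 - F (1 - v)\<close>
  is \<open>J 1\<close> applied to \<open>v\<close> minus this term.\<close>

definition critical_defect :: "real^'n \<Rightarrow> 'n \<Rightarrow> real" where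
  "critical_defect v i = (if i \<in> L then 0 else v $ pj i * v $ pk i)"

text \<open>\<open>path_le\<close> applies to \<open>1 - q\<close>, because in a product row
  \<open>q i\<close> is at most either factor.\<close>

lemma one_minus_q_path:
  assumes q1: "\<And>i. q $ i < 1" and path: "(i, j) \<in> edges\<^sup>*"
  shows "1 - q $ j \<le> 2 ^ len_sum * (1 - q $ i)"
proof -
  have "(1 - q) $ j \<le> 2 ^ len_sum * (1 - q) $ i"
  proof (rule path_le[OF _ _ _ path])
    show "0 \<le> (1 - q) $ i" for i using q1[of i] by simp
    show "(\<Sum>j\<in>UNIV. a i j * (1 - q) $ j) \<le> (1 - q) $ i" if "i \<in> L" for i
      using row_le_1[OF that] F_lin[OF that, of q] F_q
      by (simp add: right_diff_distrib sum_subtractf)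
    fix i assume "i \<notin> L"
    then have qi: "q $ i = q $ pj i * q $ pk i" using F_prod[of i q] F_q by simp
    have "q $ pj i * q $ pk i \<le> q $ pj i * 1" "q $ pj i * q $ pk i \<le> 1 * q $ pk i"
      using q_pos q1 by (auto intro!: mult_left_mono mult_right_mono simp: less_imp_le)
    then show "(1 - q) $ pj i \<le> 2 * (1 - q) $ i \<and> (1 - q) $ pk i \<le> 2 * (1 - q) $ i"
      using q1[of "pj i"] q1[of "pk i"] qi by simp
  qed
  then show ?thesis by simp
qed

context
  fixes S :: "'n set" and v :: "real^'n"
  assumes q1: "\<And>i. q $ i < 1"
    and closed: "\<And>i j. i \<in> S \<Longrightarrow> (i, j) \<in> edges \<Longrightarrow> j \<in> S"
    and connected: "\<And>i j. i \<in> S \<Longrightarrow> j \<in> S \<Longrightarrow> (i, j) \<in> edges\<^sup>*"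
    and full: "\<And>i. i \<in> S \<Longrightarrow> \<not> deficient i"
    and v: "v = (\<chi> i. if i \<in> S then 1 - q $ i else 0)"
begin

lemma v_nonneg: "0 \<le> v $ i"
  and v_pos: "i \<in> S \<Longrightarrow> 0 < v $ i"
  and v_notin: "i \<notin> S \<Longrightarrow> v $ i = 0"
  using q1[of i] by (auto simp: v)

lemma edge_J_1_pos: "(i, j) \<in> edges \<Longrightarrow> 0 < J 1 $ i $ j"
  by (auto simp: J_def edges_def split: if_splits)

text \<open>As \<open>F 1 = 1\<close> on rows that are not deficient, this is the exact expansion of
  \<open>F q = q\<close> around 1. Closedness of \<open>S\<close> keeps coordinates outside
  \<open>S\<close> from entering.\<close>

lemma v_eq:
  assumes i: "i \<in> S"
  shows "v $ i = (J 1 *v v) $ i - critical_defect v i"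
proof (cases "i \<in> L")
  case True
  have "a i j * v $ j = a i j - a i j * q $ j" for j
    using closed[OF i, of j] a_nonneg[OF True, of j] True
    by (cases "a i j = 0") (auto simp: v edges_def right_diff_distrib)
  then have "(\<Sum>j\<in>UNIV. a i j * v $ j) = (\<Sum>j\<in>UNIV. a i j) - (\<Sum>j\<in>UNIV. a i j * q $ j)"
    by (simp add: sum_subtractf)
  moreover have "q $ i = c i + (\<Sum>j\<in>UNIV. a i j * q $ j)" using F_lin[OF True, of q] F_q by simp
  moreover have "c i + (\<Sum>j\<in>UNIV. a i j) = 1"
    using full[OF i] row_le_1[OF True] True by (simp add: deficient_def)
  ultimately show ?thesis using True i by (simp add: J_mult_lin critical_defect_def v)
next
  case False
  then have "pj i \<in> S" "pk i \<in> S" using closed[OF i] by (auto simp: edges_def)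
  moreover have "q $ i = q $ pj i * q $ pk i" using F_prod[OF False, of q] F_q by simp
  ultimately show ?thesis using False i
    by (simp add: J_mult_prod critical_defect_def v algebra_simps)
qed

lemma critical_defect_nonneg: "0 \<le> critical_defect v i"
  using v_nonneg by (simp add: critical_defect_def)

text \<open>Since the defect is nonnegative, \<open>v\<close> is at most \<open>restricted S\<close>
  applied to \<open>v\<close>. A nonnegative resolvent would turn this into \<open>v <= 0\<close>,
  but \<open>v\<close> is positive on \<open>S\<close>.\<close>

lemma not_subcritical:
  assumes "S \<noteq> {}"
  shows "\<not> subcritical S"
proof
  assume sub: "subcritical S"
  obtain i where i: "i \<in> S" using assms by blast
  have "(v - restricted S *v v) $ j \<le> 0" for j
    using v_eq[of j] critical_defect_nonneg[of j]
    by (cases "j \<in> S") (auto simp: restricted_mult_in restricted_mult_notin v_notin)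
  then have "0 \<le> (resolvent S *v (- (v - restricted S *v v))) $ i"
    using subcritical_inverse(2)[OF sub] by (intro matrix_vector_mult_nonneg) auto
  moreover have "resolvent S *v (- (v - restricted S *v v)) = - v"
    using resolvent_left[OF sub, of "- v"] matrix_vector_mult_diff_distrib[of "restricted S" 0 v]
    by simp
  ultimately show False using v_pos[OF i] by simp
qed

text \<open>The path from \<open>reaches_slack\<close> cannot leave \<open>S\<close>, and
  \<open>S\<close> has no deficient row, so it ends at a product row with both factors in
  \<open>S\<close>.\<close>

lemma component_product_row:
  assumes "i \<in> S"
  obtains r where "r \<in> S" "0 < critical_defect v r"
proof -
  obtain r where r: "(i, r) \<in> linear_edges\<^sup>*" "r \<notin> L \<or> deficient r"
    using reaches_slack[OF q1] by blast
  have "linear_edges \<subseteq> edges" by (auto simp: linear_edges_def edges_def)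
  then have "(i, r) \<in> edges\<^sup>*" using r(1) rtrancl_mono by blast
  then have rS: "r \<in> S" using assms by (induction rule: rtrancl_induct) (use closed in blast)+
  then have "r \<notin> L" using r(2) full by blast
  moreover from this have "pj r \<in> S" "pk r \<in> S" using closed[OF rS] by (auto simp: edges_def)
  ultimately have "0 < critical_defect v r" by (simp add: critical_defect_def v_pos)
  with rS show ?thesis by (rule that)
qed

text \<open>The elimination step: \<open>T\<close> is a maximal subcritical part of the component and \<open>u\<close> one of the
  remaining rows. Eliminating \<open>T\<close> turns row \<open>u\<close> into an identity whose coefficients
  \<open>h\<close> are nonnegative rationals with a small denominator and whose other side is quadratic
  in \<open>v\<close>; some \<open>h w\<close> is positive, because otherwise no product row would be reachable.\<close>

lemma component_critical:
  assumes ne: "S \<noteq> {}" and mu: "\<And>i. v $ i \<le> \<mu>"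
  shows "\<exists>w\<in>S. v $ w \<le> 2 ^ (4 * len_sum) * \<mu>\<^sup>2"
proof -
  have "subcritical {}"
    unfolding subcritical_def vec_less_def
    by (rule exI[of _ 1]) (simp add: restricted_mult_notin)
  then have "finite {T. T \<subseteq> S \<and> subcritical T}" "{T. T \<subseteq> S \<and> subcritical T} \<noteq> {}" by auto
  from finite_has_maximal[OF this] obtain T where "T \<in> {T. T \<subseteq> S \<and> subcritical T}"
    and max': "\<forall>T'\<in>{T. T \<subseteq> S \<and> subcritical T}. T \<subseteq> T' \<longrightarrow> T = T'" by (rule bexE)
  then have TS: "T \<subseteq> S" and T: "subcritical T" by simp_all
  have max: "T' = T" if "T' \<subseteq> S" "subcritical T'" "T \<subseteq> T'" for T'
    using bspec[OF max', of T'] that by simp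
  have "T \<noteq> S" using not_subcritical[OF ne] T by blast
  then obtain u where uS: "u \<in> S" and uT: "u \<notin> T" using TS by blast
  define G where "G = J 1 ** resolvent T"
  define g where "g w = G $ u $ w" for w
  have g_sum: "g w = (\<Sum>j\<in>UNIV. J 1 $ u $ j * resolvent T $ j $ w)" for w
    by (simp add: g_def G_def matrix_matrix_mult_def)
  have g0: "0 \<le> g w" for w
    unfolding g_sum by (intro sum_nonneg mult_nonneg_nonneg J_1_nonneg resolvent_nonneg[OF T])
  \<comment> \<open>By maximality row \<open>u\<close> cannot join \<open>T\<close>, so its diagonal
    coefficient after elimination is at least 1.\<close>
  have gu: "1 \<le> g u"
  proof (rule ccontr)
    assume "\<not> 1 \<le> g u"
    then have "subcritical (insert u T)" using T uT by (intro subcritical_insert) (simp_all add: g_def G_def)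
    then have "insert u T = T" using TS uS by (intro max) auto
    then show False using uT by blast
  qed
  have g_J: "J 1 $ u $ w \<le> g w" for w
  proof -
    have "J 1 $ u $ w * 1 \<le> J 1 $ u $ w * resolvent T $ w $ w"
      by (intro mult_left_mono resolvent_ge_1[OF T] J_1_nonneg)
    also have "\<dots> \<le> g w" unfolding g_sum
      by (rule member_le_sum) (auto intro!: mult_nonneg_nonneg J_1_nonneg resolvent_nonneg[OF T])
    finally show ?thesis by simp
  qed
  have g_step: "g x * J 1 $ x $ y \<le> g y" if "x \<in> T" for x y
  proof -
    have "g x * J 1 $ x $ y = (\<Sum>j\<in>UNIV. J 1 $ u $ j * (resolvent T $ j $ x * restricted T $ x $ y))"
      using that by (simp add: g_sum sum_distrib_right restricted_def mult.assoc)
    also have "\<dots> \<le> g y"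
      unfolding g_sum by (intro sum_mono mult_left_mono resolvent_step[OF T] J_1_nonneg)
    finally show ?thesis .
  qed
  obtain D where D0: "0 < D" and D_Int: "D \<in> \<int>" and D_le: "D \<le> 2 ^ (\<Sum>i\<in>T. len i)"
    and DN: "\<And>i j. D * resolvent T $ i $ j \<in> \<int>"
    and N_sum: "\<And>i. (\<Sum>j\<in>UNIV. resolvent T $ i $ j) \<le> 2 ^ (2 * len_sum)"
    by (rule resolvent_denominator[OF T]) blast
  have g_total: "(\<Sum>w\<in>UNIV. g w) \<le> 2 * 2 ^ (2 * len_sum)"
  proof -
    have "(\<Sum>w\<in>UNIV. g w) = (\<Sum>j\<in>UNIV. J 1 $ u $ j * (\<Sum>w\<in>UNIV. resolvent T $ j $ w))"
      unfolding g_sum sum_distrib_left by (rule sum.swap)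
    also have "\<dots> \<le> (\<Sum>j\<in>UNIV. J 1 $ u $ j * 2 ^ (2 * len_sum))"
      by (intro sum_mono mult_left_mono N_sum J_1_nonneg)
    also have "\<dots> = (\<Sum>j\<in>UNIV. J 1 $ u $ j) * 2 ^ (2 * len_sum)" by (simp add: sum_distrib_right)
    also have "\<dots> \<le> 2 * 2 ^ (2 * len_sum)"
      using J_1_row_sum[of u] by (intro mult_right_mono) (auto split: if_splits)
    finally show ?thesis .
  qed
  \<comment> \<open>The coefficients left in row \<open>u\<close> once \<open>T\<close> is
    substituted away and \<open>v u\<close> is moved across; \<open>gu\<close> makes them
    nonnegative.\<close>
  define h where "h w = (if w \<in> T then 0 else g w - (if w = u then 1 else 0))" for w
  have h0: "0 \<le> h w" for w using g0 gu by (simp add: h_def)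
  have h_ge: "1 \<le> 2 ^ len_sum * h w" if "0 < h w" for w
  proof -
    have "den u * D * g w = (\<Sum>j\<in>UNIV. (den u * J 1 $ u $ j) * (D * resolvent T $ j $ w))"
      by (simp add: g_sum sum_distrib_left mult_ac)
    also have "\<dots> \<in> \<int>" by (rule Ints_sum) (rule Ints_mult[OF J_1_den_Ints DN])
    finally have gI: "den u * D * g w \<in> \<int>" .
    moreover have "den u * D \<in> \<int>" using den_Ints D_Int by (rule Ints_mult)
    ultimately have "den u * D * h w \<in> \<int>" by (auto simp: h_def right_diff_distrib)
    then have "1 \<le> den u * D * h w"
      using den_ge_1[of u] D0 that by (intro one_le_mult_of_Ints) auto
    also have "\<dots> \<le> 2 ^ len_sum * h w"
    proof (rule mult_right_mono)
      \<comment> \<open>Because \<open>u\<close> lies outside \<open>T\<close>, the lengths used for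
        \<open>den u\<close> and \<open>D\<close> add up within \<open>len_sum\<close>.\<close>
      have "den u * D \<le> 2 ^ len u * 2 ^ (\<Sum>i\<in>T. len i)"
        using D0 D_le den_le'[of u] den_ge_1[of u] by (intro mult_mono) auto
      also have "\<dots> = 2 ^ (\<Sum>i\<in>insert u T. len i)" using uT by (simp add: power_add)
      also have "\<dots> \<le> 2 ^ len_sum" by (intro power_two_sum_mono sum_mono2) auto
      finally show "den u * D \<le> 2 ^ len_sum" .
    qed (rule h0)
    finally show ?thesis .
  qed
  have identity: "(\<Sum>w\<in>UNIV. h w * v $ w)
      = critical_defect v u + (\<Sum>w\<in>T. g w * critical_defect v w)"
  proof -
    \<comment> \<open>On \<open>T\<close> only the negated defect remains, elsewhere
      \<open>v\<close> itself. Applying \<open>G\<close> to \<open>e\<close> gives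
      \<open>J 1\<close> applied to \<open>v\<close>, whose row \<open>u\<close> is known from
      \<open>v_eq\<close>.\<close>
    define e where "e = v - restricted T *v v"
    have e: "e $ w = (if w \<in> T then - critical_defect v w else v $ w)" for w
      using v_eq[of w] TS by (auto simp: e_def restricted_mult_in restricted_mult_notin)
    have "G *v e = J 1 *v v"
      using resolvent_left[OF T, of v] by (simp add: G_def e_def matrix_vector_mul_assoc[symmetric])
    then have "(G *v e) $ u = (J 1 *v v) $ u" by (rule arg_cong)
    then have "(\<Sum>w\<in>UNIV. g w * e $ w) = v $ u + critical_defect v u"
      using v_eq[OF uS] unfolding matrix_vector_mult_row[of G] g_def by linarith
    moreover have "g w * e $ w = h w * v $ w + (if w = u then v $ w else 0)
        - (if w \<in> T then g w * critical_defect v w else 0)" for w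
      using uT by (auto simp: h_def e left_diff_distrib)
    ultimately show ?thesis
      by (simp add: sum.distrib sum_subtractf sum.If_cases)
  qed
  have mu0: "0 \<le> \<mu>" using v_nonneg mu order_trans by blast
  have defect_le: "critical_defect v w \<le> \<mu>\<^sup>2" for w
    using mu v_nonneg mu0 by (auto simp: critical_defect_def power2_eq_square intro: mult_mono)
  have rhs: "critical_defect v u + (\<Sum>w\<in>T. g w * critical_defect v w) \<le> 2 ^ (3 * len_sum) * \<mu>\<^sup>2"
  proof -
    have "(\<Sum>w\<in>T. g w * critical_defect v w) \<le> (\<Sum>w\<in>T. g w * \<mu>\<^sup>2)"
      by (intro sum_mono mult_left_mono defect_le g0)
    also have "\<dots> \<le> (\<Sum>w\<in>UNIV. g w) * \<mu>\<^sup>2"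
      unfolding sum_distrib_right by (intro sum_mono2) (auto intro: mult_nonneg_nonneg g0)
    also have "\<dots> \<le> 2 * 2 ^ (2 * len_sum) * \<mu>\<^sup>2" by (intro mult_right_mono g_total) simp
    finally have "critical_defect v u + (\<Sum>w\<in>T. g w * critical_defect v w)
        \<le> (1 + 2 * 2 ^ (2 * len_sum)) * \<mu>\<^sup>2"
      using defect_le[of u] by (simp add: distrib_right)
    also have "\<dots> \<le> 2 ^ (3 * len_sum) * \<mu>\<^sup>2"
    proof (rule mult_right_mono)
      have "(2::real) ^ 2 \<le> 2 ^ len_sum" by (intro power_increasing len_sum_ge_2) simp
      then have "4 * 2 ^ (2 * len_sum) \<le> (2::real) ^ len_sum * 2 ^ (2 * len_sum)"
        by (intro mult_right_mono) auto
      also have "\<dots> = 2 ^ (3 * len_sum)" by (simp add: power_add[symmetric])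
      finally show "1 + 2 * 2 ^ (2 * len_sum) \<le> (2::real) ^ (3 * len_sum)"
        using one_le_power[of "2::real" "2 * len_sum"] by linarith
    qed simp
    finally show ?thesis .
  qed
  \<comment> \<open>If \<open>h\<close> vanished on \<open>S\<close>, both sides of
    \<open>identity\<close> would be 0, so neither \<open>u\<close> nor a row of \<open>T\<close>
    with \<open>g > 0\<close> has a defect. Only such rows are then reachable from \<open>u\<close>,
    yet some row of \<open>S\<close> has a defect.\<close>
  have "\<exists>w\<in>S. 0 < h w"
  proof (rule ccontr)
    assume "\<not> ?thesis"
    then have hS: "h w = 0" if "w \<in> S" for w using that h0[of w] by force
    have "(\<Sum>w\<in>UNIV. h w * v $ w) = 0"
      using hS v_notin by (intro sum.neutral) (metis mult_zero_left mult_zero_right)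
    moreover have "0 \<le> (\<Sum>w\<in>T. g w * critical_defect v w)"
      by (intro sum_nonneg mult_nonneg_nonneg g0 critical_defect_nonneg)
    ultimately have u_zero: "critical_defect v u = 0"
      and "(\<Sum>w\<in>T. g w * critical_defect v w) = 0"
      using identity critical_defect_nonneg[of u] by linarith+
    then have T_zero: "g w * critical_defect v w = 0" if "w \<in> T" for w
      using that g0 critical_defect_nonneg by (subst (asm) sum_nonneg_eq_0_iff) auto
    have reached: "x \<in> S \<and> (x = u \<or> x \<in> T \<and> 0 < g x)" if "(u, x) \<in> edges\<^sup>*" for x
      using that
    proof (induction rule: rtrancl_induct)
      case (step x y)
      then have yS: "y \<in> S" using closed by blast
      have J0: "0 < J 1 $ x $ y" using step.hyps(2) by (rule edge_J_1_pos)
      have "0 < g y"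
      proof (cases "x = u")
        case True
        then show ?thesis using g_J[of y] J0 by simp
      next
        case False
        then have "x \<in> T" "0 < g x" using step.IH by auto
        then show ?thesis using g_step[of x y] J0 mult_pos_pos[of "g x" "J 1 $ x $ y"] by linarith
      qed
      then show ?case using yS hS[OF yS] by (auto simp: h_def split: if_splits)
    qed (use uS in simp)
    obtain r where r: "r \<in> S" "0 < critical_defect v r" using component_product_row[OF uS] by blast
    show False using reached[OF connected[OF uS r(1)]] u_zero T_zero[of r] r(2) by auto
  qed
  then obtain w where wS: "w \<in> S" and hw: "0 < h w" by blast
  have "v $ w = 1 * v $ w" by simp
  also have "\<dots> \<le> 2 ^ len_sum * h w * v $ w" by (intro mult_right_mono h_ge hw v_nonneg)
  also have "\<dots> \<le> 2 ^ len_sum * (\<Sum>w\<in>UNIV. h w * v $ w)"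
    using member_le_sum[of w UNIV "\<lambda>w. h w * v $ w"] h0 v_nonneg by (simp add: mult.assoc)
  also have "\<dots> \<le> 2 ^ len_sum * (2 ^ (3 * len_sum) * \<mu>\<^sup>2)"
    unfolding identity by (intro mult_left_mono rhs) simp
  also have "\<dots> = 2 ^ (4 * len_sum) * \<mu>\<^sup>2" by (simp add: power_add[symmetric] mult.assoc[symmetric])
  finally show ?thesis using wS by blast
qed

end

end

section \<open>The inverse bounds\<close>

lemma vec_min_le: "vec_min v \<le> v $ i"
  unfolding vec_min_def by (intro Min_le) auto

lemma vec_min_mem: "\<exists>i. vec_min v = v $ i"
proof -
  have "vec_min v \<in> range (\<lambda>i. v $ i)" unfolding vec_min_def by (intro Min_in) auto
  then show ?thesis by auto
qed

context normal_form_lfp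
begin

text \<open>For the largest value \<open>m\<close> of \<open>1 - q\<close> on \<open>S\<close>,
  connectivity and \<open>component_critical\<close> give
  \<open>m <= 2 ^ (5 * len_sum) * m^2\<close>; divide by \<open>m\<close>.\<close>

lemma component_max_ge:
  assumes q1: "\<And>i. q $ i < 1" and i: "i \<in> S"
    and closed: "\<And>i j. i \<in> S \<Longrightarrow> (i, j) \<in> edges \<Longrightarrow> j \<in> S"
    and connected: "\<And>i j. i \<in> S \<Longrightarrow> j \<in> S \<Longrightarrow> (i, j) \<in> edges\<^sup>*"
    and full: "\<And>i. i \<in> S \<Longrightarrow> \<not> deficient i"
  shows "\<exists>j\<in>S. 1 \<le> 2 ^ (5 * len_sum) * (1 - q $ j)"
proof -
  define m where "m = Max ((\<lambda>j. 1 - q $ j) ` S)"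
  have "m \<in> (\<lambda>j. 1 - q $ j) ` S" unfolding m_def using i by (intro Max_in) auto
  then obtain j where j: "j \<in> S" "m = 1 - q $ j" by blast
  have m_ge: "1 - q $ k \<le> m" if "k \<in> S" for k unfolding m_def using that by (intro Max_ge) auto
  have m0: "0 < m" using j q1[of j] by simp
  define v :: "real^'n" where "v = (\<chi> i. if i \<in> S then 1 - q $ i else 0)"
  have "\<exists>w\<in>S. v $ w \<le> 2 ^ (4 * len_sum) * m\<^sup>2"
  proof (rule component_critical[OF q1 closed connected full v_def])
    show "S \<noteq> {}" using i by blast
    show "v $ i \<le> m" for i using m_ge[of i] m0 by (simp add: v_def)
  qed
  then obtain w where w: "w \<in> S" "v $ w \<le> 2 ^ (4 * len_sum) * m\<^sup>2" by blast
  have "m \<le> 2 ^ len_sum * v $ w"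
    using one_minus_q_path[OF q1 connected[OF w(1) j(1)]] j(2) w(1) by (simp add: v_def)
  also have "\<dots> \<le> 2 ^ len_sum * (2 ^ (4 * len_sum) * m\<^sup>2)" by (intro mult_left_mono w) simp
  also have "\<dots> = (2 ^ (5 * len_sum) * m) * m"
    by (simp add: power2_eq_square power_add[symmetric] mult.assoc[symmetric])
  finally have "1 * m \<le> (2 ^ (5 * len_sum) * m) * m" by simp
  then have "1 \<le> 2 ^ (5 * len_sum) * m" using m0 mult_le_cancel_right_pos by blast
  then show ?thesis using j by blast
qed

text \<open>Five factors \<open>2 ^ len_sum\<close> handle some vertex of a bottom component
  reachable from \<open>i\<close>; the sixth carries the bound back to \<open>i\<close>.\<close>

lemma one_minus_q_ge:
  assumes q1: "\<And>i. q $ i < 1"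
  shows "1 \<le> 2 ^ (6 * len_sum) * (1 - q $ i)"
proof -
  define reach where "reach x = {y. (x, y) \<in> edges\<^sup>*}" for x
  \<comment> \<open>Minimality of the reachable set puts \<open>b\<close> in a bottom component:
    everything reachable from \<open>b\<close> reaches the same set.\<close>
  obtain b where b: "b \<in> reach i" "\<And>y. y \<in> reach i \<Longrightarrow> card (reach b) \<le> card (reach y)"
    using ex_has_least_nat[of "\<lambda>x. x \<in> reach i" i "\<lambda>x. card (reach x)"]
    by (auto simp: reach_def)
  have sub: "reach y \<subseteq> reach x" if "y \<in> reach x" for x y using that by (auto simp: reach_def)
  have eq: "reach y = reach b" if "y \<in> reach b" for y
  proof (rule card_subset_eq)
    have "y \<in> reach i" using that b(1) sub by blast
    then show "card (reach y) = card (reach b)"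
      using b(2) card_mono[OF _ sub[OF that]] by (simp add: order_antisym)
  qed (use sub[OF that] in auto)
  have bb: "b \<in> reach b" by (simp add: reach_def)
  have "\<exists>j\<in>reach b. 1 \<le> 2 ^ (5 * len_sum) * (1 - q $ j)"
  proof (cases "\<exists>j\<in>reach b. deficient j")
    case True
    then obtain j where j: "j \<in> reach b" "deficient j" by blast
    have jL: "j \<in> L" using j(2) by (simp add: deficient_def)
    have "(\<Sum>k\<in>UNIV. a j k * q $ k) \<le> (\<Sum>k\<in>UNIV. a j k * 1)"
      using q1 a_nonneg[OF jL] by (intro sum_mono mult_left_mono) (auto simp: less_imp_le)
    then have le: "1 - c j - (\<Sum>k\<in>UNIV. a j k) \<le> 1 - q $ j"
      using F_lin[OF jL, of q] F_q by simp
    have "1 \<le> 2 ^ len_sum * (1 - c j - (\<Sum>k\<in>UNIV. a j k))" by (rule deficient_ge[OF j(2)])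
    also have "\<dots> \<le> 2 ^ len_sum * (1 - q $ j)" by (intro mult_left_mono le) simp
    also have "\<dots> \<le> 2 ^ (5 * len_sum) * (1 - q $ j)"
      using q1[of j] by (intro mult_right_mono power_increasing) auto
    finally show ?thesis using j(1) by blast
  next
    case False
    show ?thesis
    proof (rule component_max_ge[OF q1 bb])
      show "y \<in> reach b" if "x \<in> reach b" "(x, y) \<in> edges" for x y
        using that unfolding reach_def by (auto intro: rtrancl_into_rtrancl)
      show "(x, y) \<in> edges\<^sup>*" if "x \<in> reach b" "y \<in> reach b" for x y
        using eq[OF that(1)] that(2) by (auto simp: reach_def)
    qed (use False in blast)
  qed
  then obtain j where j: "j \<in> reach b" "1 \<le> 2 ^ (5 * len_sum) * (1 - q $ j)" by blast
  have "(i, j) \<in> edges\<^sup>*" using sub[OF b(1)] j(1) by (auto simp: reach_def)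
  then have "2 ^ (5 * len_sum) * (1 - q $ j) \<le> 2 ^ (5 * len_sum) * (2 ^ len_sum * (1 - q $ i))"
    using one_minus_q_path[OF q1] by (intro mult_left_mono) auto
  also have "\<dots> = 2 ^ (6 * len_sum) * (1 - q $ i)"
    by (simp add: power_add[symmetric] mult.assoc[symmetric])
  finally show ?thesis using j(2) by linarith
qed

text \<open>By \<open>F_diff\<close>, \<open>J\<close> at \<open>(1 + q) / 2\<close> maps
  \<open>1 - q\<close> to \<open>F 1 - q <= 1 - q\<close>. Replacing 1 by \<open>y\<close> lowers
  the product rows by multiples of \<open>(1 - y) / 2\<close>, and this is their slack.\<close>

lemma inverse_bound_less:
  assumes q1: "\<And>i. q $ i < 1" and y0: "\<And>i. 0 \<le> y $ i" and y1: "\<And>i. y $ i < 1"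
  defines "B \<equiv> J ((1/2) *\<^sub>R (y + q))"
  shows "invertible (mat 1 - B)" "nonneg_matrix (matrix_inv (mat 1 - B))"
    "matrix_norm_inf (matrix_inv (mat 1 - B)) \<le> 2 ^ (8 * len_sum) * (2 / vec_min (1 - y))"
proof -
  define d where "d = vec_min (1 - y)"
  have d_le: "d \<le> 1 - y $ i" for i using vec_min_le[of "1 - y" i] by (simp add: d_def)
  obtain i0 where "d = (1 - y) $ i0" using vec_min_mem[of "1 - y"] by (auto simp: d_def)
  then have d0: "0 < d" using y1[of i0] by simp
  have d1: "d \<le> 1" using d_le[of i0] y0[of i0] by linarith
  define u where "u = 1 - q"
  \<comment> \<open>\<open>d / 2\<close> bounds \<open>(1 - y) / 2\<close> from below and
    \<open>2 ^ (6 * len_sum)\<close> comes from \<open>one_minus_q_ge\<close>; deficient rows have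
    at least this much slack.\<close>
  define \<sigma> where "\<sigma> = d / 2 / 2 ^ (6 * len_sum)"
  have s0: "0 < \<sigma>" using d0 by (simp add: \<sigma>_def)
  have u0: "0 < u $ i" for i using q1[of i] by (simp add: u_def)
  have slack_lin: "u $ i - (B *v u) $ i = 1 - c i - (\<Sum>j\<in>UNIV. a i j)" if "i \<in> L" for i
    using F_lin[OF that, of q] F_q
    by (simp add: B_def u_def J_mult_lin[OF that] right_diff_distrib sum_subtractf)
  have slack_prod: "\<sigma> \<le> u $ i - (B *v u) $ i" if "i \<notin> L" for i
  proof -
    have "q $ i = q $ pj i * q $ pk i" using F_prod[OF that, of q] F_q by simp
    then have eq: "u $ i - (B *v u) $ i
        = (1 - y $ pk i) / 2 * u $ pj i + (1 - y $ pj i) / 2 * u $ pk i"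
      by (simp add: B_def u_def J_mult_prod[OF that] field_simps)
    have "d / 2 * u $ pj i \<le> (1 - y $ pk i) / 2 * u $ pj i"
      using u0[of "pj i"] d_le[of "pk i"] by (intro mult_right_mono) auto
    moreover have "0 \<le> (1 - y $ pj i) / 2 * u $ pk i"
      using u0[of "pk i"] y1[of "pj i"] by simp
    moreover have "\<sigma> \<le> d / 2 * u $ pj i"
    proof -
      have "d / 2 * 1 \<le> d / 2 * (2 ^ (6 * len_sum) * u $ pj i)"
        using one_minus_q_ge[OF q1, of "pj i"] d0 by (intro mult_left_mono) (auto simp: u_def)
      then show ?thesis by (simp add: \<sigma>_def divide_le_eq mult_ac)
    qed
    ultimately show ?thesis unfolding eq by linarith
  qed
  have Bu: "(B *v u) $ i \<le> u $ i" for i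
    using slack_lin[of i] slack_prod[of i] row_le_1[of i] s0 by (cases "i \<in> L") auto
  have reach: "\<exists>i. (j, i) \<in> linear_edges\<^sup>* \<and> \<sigma> \<le> u $ i - (B *v u) $ i" for j
  proof -
    obtain i where i: "(j, i) \<in> linear_edges\<^sup>*" "i \<notin> L \<or> deficient i"
      using reaches_slack[OF q1] by blast
    have "\<sigma> \<le> u $ i - (B *v u) $ i"
    proof (cases "i \<in> L")
      case True
      then have "deficient i" using i(2) by blast
      have "\<sigma> \<le> 1 / 2 ^ (6 * len_sum)"
        unfolding \<sigma>_def using d1 by (intro divide_right_mono) auto
      also have "\<dots> \<le> 1 / 2 ^ len_sum"
        by (intro divide_left_mono power_increasing) auto
      also have "\<dots> \<le> 1 - c i - (\<Sum>j\<in>UNIV. a i j)"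
        using deficient_ge[OF \<open>deficient i\<close>] by (simp add: divide_le_eq mult_ac)
      finally show ?thesis using slack_lin[OF True] by simp
    qed (rule slack_prod)
    with i(1) show ?thesis by blast
  qed
  have B: "nonneg_matrix B"
    unfolding B_def using y0 q_pos by (intro J_nonneg) (simp add: less_imp_le)
  have vu: "vec_less 0 u" using u0 by (simp add: vec_less_def)
  have um: "u $ i \<le> 1" for i using q_pos[of i] by (simp add: u_def)
  note bound = substochastic_inverse_bound[OF B vu um Bu _ s0 reach, of len]
  have edge: "1 \<le> 2 ^ len i * B $ i $ j" if "(i, j) \<in> linear_edges" for i j
    unfolding B_def using that by (rule linear_edge_weight)
  show "invertible (mat 1 - B)" "nonneg_matrix (matrix_inv (mat 1 - B))"
    using bound(1,2) edge by blast+
  \<comment> \<open>One factor \<open>2 ^ len_sum\<close> pays for the dimension, one for the path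
    and six for \<open>\<sigma>\<close>.\<close>
  have "matrix_norm_inf (matrix_inv (mat 1 - B)) \<le> real CARD('n) * (2 ^ len_sum * 1 / \<sigma>)"
    using bound(3) edge by blast
  also have "\<dots> \<le> 2 ^ len_sum * (2 ^ len_sum * 1 / \<sigma>)"
    using s0 by (intro mult_right_mono card_le_pow_len_sum) auto
  also have "\<dots> = 2 ^ (8 * len_sum) * (2 / d)"
    using d0 by (simp add: \<sigma>_def power_add[symmetric] field_simps)
  finally show "matrix_norm_inf (matrix_inv (mat 1 - B)) \<le> 2 ^ (8 * len_sum) * (2 / vec_min (1 - y))"
    by (simp add: d_def)
qed

text \<open>Here \<open>1 - q\<close> is zero. An iterate \<open>x\<close> close to 1 has
  \<open>x <= F x\<close>, so \<open>u = 1 - x\<close> is positive and does not grow under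
  \<open>J\<close> at \<open>(1 + x) / 2\<close>; passing to the smaller \<open>y\<close> creates
  slack in product rows. Strong connectivity makes the entries of \<open>u\<close>
  comparable.\<close>

lemma inverse_bound_eq_1:
  assumes q1: "q = 1" and conn: "\<And>i j. (i, j) \<in> edges\<^sup>*"
    and y0: "\<And>i. 0 \<le> y $ i" and y1: "\<And>i. y $ i < 1"
  defines "B \<equiv> J y"
  shows "invertible (mat 1 - B)" "nonneg_matrix (matrix_inv (mat 1 - B))"
    "matrix_norm_inf (matrix_inv (mat 1 - B)) \<le> 2 ^ (3 * len_sum) * (1 / vec_min (1 - y))"
proof -
  define d where "d = vec_min (1 - y)"
  have d_le: "d \<le> 1 - y $ i" for i using vec_min_le[of "1 - y" i] by (simp add: d_def)
  obtain i0 where "d = (1 - y) $ i0" using vec_min_mem[of "1 - y"] by (auto simp: d_def)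
  then have d0: "0 < d" using y1[of i0] by simp
  have d1: "d \<le> 1" using d_le[of i0] y0[of i0] by linarith
  have B: "nonneg_matrix B" unfolding B_def using y0 by (rule J_nonneg)
  have F1: "F 1 = 1" using F_q q1 by simp
  have edge: "1 \<le> 2 ^ len i * B $ i $ j" if "(i, j) \<in> linear_edges" for i j
    unfolding B_def using that by (rule linear_edge_weight)
  \<comment> \<open>Only the ratio \<open>M / \<sigma>\<close> enters the bound, so \<open>u\<close>
    may be arbitrarily small.\<close>
  have "\<exists>u M \<sigma>. vec_less 0 u \<and> (\<forall>i. u $ i \<le> M) \<and> (\<forall>i. (B *v u) $ i \<le> u $ i) \<and> 0 < \<sigma> \<and>
      (\<forall>j. \<exists>i. (j, i) \<in> linear_edges\<^sup>* \<and> \<sigma> \<le> u $ i - (B *v u) $ i) \<and> M / \<sigma> \<le> 2 ^ len_sum / d"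
  proof (cases "\<forall>i. i \<in> L")
    case True
    then have iL: "i \<in> L" for i by blast
    have le: "linear_edges = edges" by (simp add: linear_edges_def edges_def iL)
    have slack: "1 - (B *v 1) $ i = c i" for i
      using F_lin[of i 1] F1 iL by (simp add: B_def J_mult_lin)
    \<comment> \<open>A purely linear system without constant terms fixes 0, against
      \<open>q > 0\<close>.\<close>
    have "\<exists>i. 0 < c i"
    proof (rule ccontr)
      assume "\<not> ?thesis"
      then have "c i = 0" for i using c_nonneg[OF iL, of i] by (metis order_le_less)
      then have "F 0 = 0" using iL by (simp add: F_def vec_eq_iff)
      then have "q $ i \<le> 0 $ i" for i by (intro q_least) auto
      then show False using q_pos by (metis not_less zero_index)
    qed
    then obtain i where i: "0 < c i" by blast
    have ci: "1 / 2 ^ len_sum \<le> c i" using const_ge[OF iL i] by (simp add: divide_le_eq mult_ac)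
    have "1 / (1 / 2 ^ len_sum) \<le> 2 ^ len_sum / d" using d0 d1 by (simp add: le_divide_eq)
    moreover have "(B *v 1) $ i \<le> 1 $ i" for i
      using slack[of i] c_nonneg[OF iL, of i] by simp
    moreover have "\<forall>j. \<exists>i. (j, i) \<in> linear_edges\<^sup>* \<and> 1 / 2 ^ len_sum \<le> 1 $ i - (B *v 1) $ i"
      using conn slack ci by (auto simp: le)
    ultimately show ?thesis
      by (intro exI[of _ 1] exI[of _ "1 / 2 ^ len_sum"]) (auto simp: vec_less_def)
  next
    case False
    then obtain p where p: "p \<notin> L" by blast
    have "eventually (\<lambda>k. \<forall>i. 1 - d < iterate k $ i) sequentially"
    proof (intro eventually_all_finite)
      fix i
      have "(\<lambda>k. iterate k $ i) \<longlonglongrightarrow> 1" using iterate_tendsto[of i] q1 by simp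
      then show "eventually (\<lambda>k. 1 - d < iterate k $ i) sequentially"
        using d0 by (intro order_tendstoD(1)) auto
    qed
    then obtain k where k: "\<And>i. 1 - d < iterate k $ i" by (auto simp: eventually_sequentially)
    define x where "x = iterate k"
    define u where "u = 1 - x"
    have u0: "0 < u $ i" for i using iterate_less_1[of k i] by (simp add: u_def x_def)
    have ud: "u $ i \<le> d" for i using k[of i] by (simp add: u_def x_def)
    have x0: "0 \<le> x $ i" for i using iterate_nonneg by (simp add: x_def)
    have Ju: "(J ((1/2) *\<^sub>R (1 + x)) *v u) $ i \<le> u $ i" for i
      using F_diff[of 1 i x] iterate_le_F[of k i] F1 by (simp add: u_def x_def)
    have lin: "(\<Sum>j\<in>UNIV. a i j * u $ j) \<le> u $ i" if "i \<in> L" for i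
      using Ju[of i] by (simp add: J_mult_lin[OF that])
    have prod: "(1 + x $ pk i) / 2 * u $ pj i + (1 + x $ pj i) / 2 * u $ pk i \<le> u $ i"
      if "i \<notin> L" for i
      using Ju[of i] by (simp add: J_mult_prod[OF that])
    have path: "u $ j \<le> 2 ^ len_sum * u $ i" for i j
    proof (rule path_le[OF _ lin _ conn])
      show "0 \<le> u $ i" for i using u0 by (simp add: less_imp_le)
      fix i assume i: "i \<notin> L"
      have "1 / 2 * u $ pj i \<le> (1 + x $ pk i) / 2 * u $ pj i"
        "1 / 2 * u $ pk i \<le> (1 + x $ pj i) / 2 * u $ pk i"
        "0 \<le> 1 / 2 * u $ pj i" "0 \<le> 1 / 2 * u $ pk i"
        using x0[of "pk i"] x0[of "pj i"] u0[of "pj i"] u0[of "pk i"]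
        by (auto intro!: mult_right_mono)
      then show "u $ pj i \<le> 2 * u $ i \<and> u $ pk i \<le> 2 * u $ i" using prod[OF i] by linarith
    qed
    define M where "M = (MAX i. u $ i)"
    have "M \<in> range (\<lambda>i. u $ i)" unfolding M_def by (intro Max_in) auto
    then obtain m where m: "M = u $ m" by auto
    have M_ge: "u $ i \<le> M" for i unfolding M_def by (intro Max_ge) auto
    have M0: "0 < M" using u0 m by simp
    have M_le: "M / 2 ^ len_sum \<le> u $ i" for i
      using path[of m i] m by (simp add: divide_le_eq mult_ac)
    define \<sigma> where "\<sigma> = d * (M / 2 ^ len_sum)"
    have s0: "0 < \<sigma>" using d0 M0 by (simp add: \<sigma>_def)
    have slack: "\<sigma> \<le> u $ i - (B *v u) $ i" if "i \<notin> L" for i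
    proof -
      \<comment> \<open>From \<open>x k >= 1 - d\<close> and \<open>y k <= 1 - d\<close> each factor
        keeps \<open>d / 2\<close>; the two summands together give \<open>\<sigma>\<close>.\<close>
      have half: "d / 2 * (M / 2 ^ len_sum) \<le> ((1 + x $ k) / 2 - y $ k) * u $ j" for j k
      proof (rule mult_mono)
        have "1 - x $ k \<le> d" using ud[of k] by (simp add: u_def)
        then show "d / 2 \<le> (1 + x $ k) / 2 - y $ k"
          using d_le[of k] by (simp add: field_simps)
        then show "0 \<le> (1 + x $ k) / 2 - y $ k" using d0 by linarith
      qed (use M_le M0 in auto)
      have "\<sigma> = d / 2 * (M / 2 ^ len_sum) + d / 2 * (M / 2 ^ len_sum)"
        by (simp add: \<sigma>_def field_simps)
      also have "\<dots> \<le> ((1 + x $ pk i) / 2 - y $ pk i) * u $ pj i + ((1 + x $ pj i) / 2 - y $ pj i) * u $ pk i"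
        by (intro add_mono half)
      also have "\<dots> \<le> u $ i - (B *v u) $ i"
        using prod[OF that] by (simp add: B_def J_mult_prod[OF that] left_diff_distrib)
      finally show ?thesis .
    qed
    have Bu: "(B *v u) $ i \<le> u $ i" for i
      using lin[of i] slack[of i] s0 by (cases "i \<in> L") (auto simp: B_def J_mult_lin)
    \<comment> \<open>Cutting a path to \<open>p\<close> at its first product row leaves only linear
      edges.\<close>
    have "\<exists>i. (j, i) \<in> linear_edges\<^sup>* \<and> i \<notin> L" for j
      using conn[of j p]
    proof (induction rule: converse_rtrancl_induct)
      case (step j k)
      show ?case
      proof (cases "j \<in> L")
        case True
        then have "(j, k) \<in> linear_edges" using step.hyps(1) by (simp add: edges_def linear_edges_def)
        then show ?thesis using step.IH by (meson converse_rtrancl_into_rtrancl)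
      qed blast
    qed (use p in blast)
    then have "\<forall>j. \<exists>i. (j, i) \<in> linear_edges\<^sup>* \<and> \<sigma> \<le> u $ i - (B *v u) $ i"
      using slack by meson
    moreover have "M / \<sigma> \<le> 2 ^ len_sum / d" using M0 by (simp add: \<sigma>_def)
    moreover have "vec_less 0 u" using u0 by (simp add: vec_less_def)
    ultimately show ?thesis using M_ge Bu s0 by blast
  qed
  then obtain u M \<sigma> where u: "vec_less 0 u" "\<And>i. u $ i \<le> M" "\<And>i. (B *v u) $ i \<le> u $ i"
    and s0: "0 < \<sigma>"
    and reach: "\<And>j. \<exists>i. (j, i) \<in> linear_edges\<^sup>* \<and> \<sigma> \<le> u $ i - (B *v u) $ i"
    and ratio: "M / \<sigma> \<le> 2 ^ len_sum / d"
    by blast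
  note bound = substochastic_inverse_bound[OF B u _ s0 reach, of len]
  show "invertible (mat 1 - B)" "nonneg_matrix (matrix_inv (mat 1 - B))"
    using bound(1,2) edge by blast+
  have "0 < u $ i0" using u(1) by (simp add: vec_less_def)
  then have M0: "0 < M" using u(2)[of i0] by linarith
  have "matrix_norm_inf (matrix_inv (mat 1 - B)) \<le> real CARD('n) * (2 ^ len_sum * M / \<sigma>)"
    using bound(3) edge by blast
  also have "\<dots> \<le> 2 ^ len_sum * (2 ^ len_sum * M / \<sigma>)"
    using s0 M0 by (intro mult_right_mono card_le_pow_len_sum) auto
  also have "\<dots> = 2 ^ (2 * len_sum) * (M / \<sigma>)" by (simp add: mult_2 power_add)
  also have "\<dots> \<le> 2 ^ (2 * len_sum) * (2 ^ len_sum / d)" by (intro mult_left_mono ratio) simp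
  also have "\<dots> = 2 ^ (3 * len_sum) * (1 / d)" by (simp add: power_add[symmetric])
  finally show "matrix_norm_inf (matrix_inv (mat 1 - B)) \<le> 2 ^ (3 * len_sum) * (1 / vec_min (1 - y))"
    by (simp add: d_def)
qed

end

section \<open>Polynomial systems\<close>

lemma rat_length_ge:
  assumes r: "r \<noteq> 0"
  shows "2 * real_of_int (snd (quotient_of r)) \<le> 2 ^ rat_length r" "2 \<le> rat_length r"
proof -
  obtain n d where nd: "quotient_of r = (n, d)" by fastforce
  have d: "0 < d" using nd by (rule quotient_of_denom_pos)
  have "n \<noteq> 0" using r quotient_of_div[OF nd] by auto
  then have "1 \<le> bitlen \<bar>n\<bar>" by (simp add: bitlen_ge_iff_power)
  then have n1: "1 \<le> nat (bitlen \<bar>n\<bar>)" by linarith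
  have "1 \<le> bitlen d" using d by (simp add: bitlen_ge_iff_power)
  then have d1: "1 \<le> nat (bitlen d)" by linarith
  have len: "rat_length r = nat (bitlen \<bar>n\<bar>) + nat (bitlen d)" by (simp add: rat_length_def nd)
  show "2 \<le> rat_length r" using n1 d1 len by simp
  have "real_of_int d \<le> 2 ^ nat (bitlen d)"
    using bitlen_bounds[OF d] by (metis less_imp_le of_int_le_iff of_int_numeral of_int_power)
  \<comment> \<open>The numerator takes at least one bit, which pays for the factor 2.\<close>
  then have "2 ^ 1 * real_of_int d \<le> 2 ^ nat (bitlen \<bar>n\<bar>) * 2 ^ nat (bitlen d)"
    using n1 d by (intro mult_mono power_increasing) auto
  then show "2 * real_of_int (snd (quotient_of r)) \<le> 2 ^ rat_length r"
    by (simp add: nd len power_add)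
qed

text \<open>A plain product instead of a least common multiple, since its size is bounded directly
  by the sum of the coefficient lengths.\<close>

definition common_denominator :: "'n polynomial \<Rightarrow> real" where
  "common_denominator p =
     (\<Prod>m\<in>Poly_Mapping.keys p. of_int (snd (quotient_of (Poly_Mapping.lookup p m))))"

lemma common_denominator_Ints: "common_denominator p \<in> \<int>"
  unfolding common_denominator_def by (intro Ints_prod) simp

lemma common_denominator_ge_1: "1 \<le> common_denominator p"
proof -
  have "1 \<le> real_of_int (snd (quotient_of r))" for r
    using quotient_of_denom_pos'[of r] by linarith
  then show ?thesis unfolding common_denominator_def by (intro prod_ge_1)
qed

lemma common_denominator_mult_Ints:
  "common_denominator p * of_rat (Poly_Mapping.lookup p m) \<in> \<int>"
proof (cases "m \<in> Poly_Mapping.keys p")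
  case False
  then show ?thesis by (simp add: in_keys_iff)
next
  case True
  obtain n d where nd: "quotient_of (Poly_Mapping.lookup p m) = (n, d)" by fastforce
  have d: "0 < d" using nd by (rule quotient_of_denom_pos)
  have r: "real_of_rat (Poly_Mapping.lookup p m) = of_int n / of_int d"
    using quotient_of_div[OF nd] by (simp add: of_rat_divide)
  have "common_denominator p = real_of_int d *
      (\<Prod>m\<in>Poly_Mapping.keys p - {m}. of_int (snd (quotient_of (Poly_Mapping.lookup p m))))"
    unfolding common_denominator_def using True by (subst prod.remove[of _ m]) (auto simp: nd)
  then have "common_denominator p * of_rat (Poly_Mapping.lookup p m) = of_int n *
      (\<Prod>m\<in>Poly_Mapping.keys p - {m}. of_int (snd (quotient_of (Poly_Mapping.lookup p m))))"
    using d by (simp add: r)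
  also have "\<dots> \<in> \<int>" by (intro Ints_mult Ints_prod) simp_all
  finally show ?thesis .
qed

lemma polynomial_length_ge:
  fixes p :: "'n::finite polynomial"
  assumes p: "p \<noteq> 0"
  shows "2 * common_denominator p \<le> 2 ^ polynomial_length p" "2 \<le> polynomial_length p"
proof -
  let ?K = "Poly_Mapping.keys p" and ?c = "Poly_Mapping.lookup p"
  have ne: "?K \<noteq> {}" using p by simp
  have sum_le: "(\<Sum>m\<in>?K. rat_length (?c m)) \<le> polynomial_length p"
    unfolding polynomial_length_def by (intro sum_mono) simp
  obtain m where m: "m \<in> ?K" using ne by blast
  have "2 \<le> rat_length (?c m)" using m by (intro rat_length_ge) (simp add: in_keys_iff)
  also have "\<dots> \<le> (\<Sum>m\<in>?K. rat_length (?c m))" using m by (intro member_le_sum) auto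
  finally show "2 \<le> polynomial_length p" using sum_le by simp
  have "(2::real) ^ 1 \<le> 2 ^ card ?K"
    using ne by (intro power_increasing) (simp_all add: Suc_le_eq card_gt_0_iff)
  then have "2 * common_denominator p \<le> 2 ^ card ?K * common_denominator p"
    using common_denominator_ge_1[of p] by (intro mult_right_mono) auto
  also have "\<dots> = (\<Prod>m\<in>?K. 2 * real_of_int (snd (quotient_of (?c m))))"
    by (simp add: common_denominator_def prod.distrib)
  also have "\<dots> \<le> (\<Prod>m\<in>?K. 2 ^ rat_length (?c m))"
  proof (rule prod_mono, intro conjI)
    fix m assume "m \<in> ?K"
    then show "2 * real_of_int (snd (quotient_of (?c m))) \<le> 2 ^ rat_length (?c m)"
      by (intro rat_length_ge) (simp add: in_keys_iff)
    show "0 \<le> 2 * real_of_int (snd (quotient_of (?c m)))"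
      using quotient_of_denom_pos'[of "?c m"] by simp
  qed
  also have "\<dots> = 2 ^ (\<Sum>m\<in>?K. rat_length (?c m))" by (simp add: power_sum)
  also have "\<dots> \<le> 2 ^ polynomial_length p" by (intro power_increasing sum_le) simp
  finally show "2 * common_denominator p \<le> 2 ^ polynomial_length p" .
qed

section \<open>Linear and product forms as polynomials\<close>

definition variable :: "'n \<Rightarrow> 'n monomial" where
  "variable j = Poly_Mapping.single j 1"

lemma lookup_variable: "Poly_Mapping.lookup (variable j) k = (if k = j then 1 else 0)"
  by (auto simp: variable_def lookup_single when_def)

lemma variable_neq_0: "variable j \<noteq> 0"
  using lookup_variable[of j j] by auto

lemma inj_variable: "inj variable"
proof (rule injI)
  fix j k :: 'n
  assume "variable j = variable k"
  then have "Poly_Mapping.lookup (variable j) j = Poly_Mapping.lookup (variable k) j" by simp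
  then show "j = k" by (simp add: lookup_variable split: if_splits)
qed

lemma linear_form_keys:
  assumes "linear_form p"
  shows "Poly_Mapping.keys p \<subseteq> insert 0 (range variable)"
proof
  fix m assume m: "m \<in> Poly_Mapping.keys p"
  obtain a0 a where p: "p = Poly_Mapping.single 0 a0 + (\<Sum>j\<in>UNIV. Poly_Mapping.single (variable j) (a j))"
    using assms by (auto simp: linear_form_def variable_def)
  show "m \<in> insert 0 (range variable)"
  proof (rule ccontr)
    assume "m \<notin> insert 0 (range variable)"
    then have "Poly_Mapping.lookup p m = 0"
      unfolding p lookup_add lookup_sum by (auto simp: lookup_single when_def intro!: sum.neutral)
    then show False using m by (simp add: in_keys_iff)
  qed
qed

lemma sum_linear_form:
  fixes p :: "'n::finite polynomial" and f :: "'n monomial \<Rightarrow> 'a::comm_monoid_add"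
  assumes "linear_form p" "\<And>m. m \<notin> Poly_Mapping.keys p \<Longrightarrow> f m = 0"
  shows "(\<Sum>m\<in>Poly_Mapping.keys p. f m) = f 0 + (\<Sum>j\<in>UNIV. f (variable j))"
proof -
  have "(\<Sum>m\<in>Poly_Mapping.keys p. f m) = (\<Sum>m\<in>insert 0 (range variable). f m)"
    using linear_form_keys[OF assms(1)] assms(2) by (intro sum.mono_neutral_left) auto
  also have "\<dots> = f 0 + (\<Sum>m\<in>range variable. f m)"
    by (subst sum.insert) (auto simp: variable_neq_0[symmetric])
  also have "(\<Sum>m\<in>range variable. f m) = (\<Sum>j\<in>UNIV. f (variable j))"
    by (subst sum.reindex) (auto simp: inj_variable)
  finally show ?thesis .
qed

lemma prod_power_variable:
  "(\<Prod>k\<in>UNIV. (x $ k) ^ Poly_Mapping.lookup (variable j) k) = (x $ j :: real)"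
  for x :: "real^'n::finite"
proof -
  have "(\<Prod>k\<in>UNIV. (x $ k) ^ Poly_Mapping.lookup (variable j) k) = (\<Prod>k\<in>UNIV. if k = j then x $ k else 1)"
    by (intro prod.cong) (auto simp: lookup_variable)
  then show ?thesis by simp
qed

lemma eval_linear_form:
  assumes "linear_form p"
  shows "eval_polynomial p x = of_rat (Poly_Mapping.lookup p 0)
    + (\<Sum>j\<in>UNIV. of_rat (Poly_Mapping.lookup p (variable j)) * x $ j)"
  unfolding eval_polynomial_def
  by (subst sum_linear_form[OF assms]) (simp_all add: prod_power_variable in_keys_iff)

lemma eval_product_form:
  assumes "p = Poly_Mapping.single (variable j + variable k) 1"
  shows "eval_polynomial p x = x $ j * x $ k"
  unfolding eval_polynomial_def
  by (simp add: assms lookup_add power_add prod.distrib prod_power_variable)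

text \<open>For the dependency graph an inclusion in \<open>edges\<close> suffices, because strong
  connectivity passes to larger graphs.\<close>

lemma normal_form_lfp_system:
  fixes P :: "'n::finite system" and q :: "real^'n"
  assumes snf: "is_SNF_PPS P" and lfp: "is_least_fixed_point P q" and pos: "vec_less 0 q"
  defines "L \<equiv> {i. linear_form (P i)}"
    and "a \<equiv> \<lambda>i j. real_of_rat (Poly_Mapping.lookup (P i) (variable j))"
    and "c \<equiv> \<lambda>i. real_of_rat (Poly_Mapping.lookup (P i) 0)"
    and "den \<equiv> \<lambda>i. if linear_form (P i) then common_denominator (P i) else 1"
    and "len \<equiv> \<lambda>i. polynomial_length (P i)"
  obtains pj pk where "normal_form_lfp L a c pj pk den len q"
    "eval_system P = normal_form_system.F L a c pj pk"
    "dependency_graph P \<subseteq> normal_form_system.edges L a pj pk"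
proof -
  have coeff: "0 \<le> Poly_Mapping.lookup (P i) m"
    and coeff_sum: "(\<Sum>m\<in>Poly_Mapping.keys (P i). Poly_Mapping.lookup (P i) m) \<le> 1"
    and form: "linear_form (P i) \<or> product_form (P i)" for i m
    using snf by (auto simp: is_SNF_PPS_def is_PPS_def)
  have "\<forall>i. \<exists>jk. i \<notin> L \<longrightarrow> P i = Poly_Mapping.single (variable (fst jk) + variable (snd jk)) 1"
    using form by (force simp: L_def product_form_def variable_def)
  from choice[OF this] obtain f
    where f: "\<And>i. i \<notin> L \<Longrightarrow> P i = Poly_Mapping.single (variable (fst (f i)) + variable (snd (f i))) 1"
    by blast
  define pj where "pj i = fst (f i)" for i
  define pk where "pk i = snd (f i)" for i
  note prod = f[folded pj_def pk_def]
  \<comment> \<open>The zero polynomial has length 0 and would break the length bounds; it is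
    excluded because it forces \<open>q i = 0\<close>.\<close>
  have nz: "P i \<noteq> 0" for i
  proof
    assume "P i = 0"
    then have "eval_system P q $ i = 0" by (simp add: eval_system_def eval_polynomial_def)
    then show False using lfp pos by (simp add: is_least_fixed_point_def vec_less_def) (metis less_irrefl)
  qed
  interpret normal_form_system L a c pj pk den len
  proof
    fix i
    show "c i + (\<Sum>j\<in>UNIV. a i j) \<le> 1" if "i \<in> L"
    proof -
      have "(\<Sum>m\<in>Poly_Mapping.keys (P i). Poly_Mapping.lookup (P i) m)
          = Poly_Mapping.lookup (P i) 0 + (\<Sum>j\<in>UNIV. Poly_Mapping.lookup (P i) (variable j))"
        using that by (intro sum_linear_form) (auto simp: L_def in_keys_iff)
      then have "real_of_rat (Poly_Mapping.lookup (P i) 0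
          + (\<Sum>j\<in>UNIV. Poly_Mapping.lookup (P i) (variable j))) \<le> real_of_rat 1"
        using coeff_sum[of i] by (simp only: of_rat_less_eq)
      then show ?thesis by (simp add: a_def c_def of_rat_add of_rat_sum)
    qed
    show "2 * den i \<le> 2 ^ len i"
    proof (cases "linear_form (P i)")
      case False
      have "(2::real) ^ 1 \<le> 2 ^ len i"
        using polynomial_length_ge(2)[OF nz, of i] unfolding len_def by (intro power_increasing) auto
      then show ?thesis using False by (simp add: den_def)
    qed (simp add: den_def len_def polynomial_length_ge nz)
  qed (auto simp: L_def a_def c_def den_def len_def coeff common_denominator_Ints
      common_denominator_ge_1 common_denominator_mult_Ints polynomial_length_ge(2) nz)
  have F: "eval_system P = F"
  proof
    fix x
    have "eval_polynomial (P i) x = F x $ i" for i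
    proof (cases "i \<in> L")
      case True
      then have "linear_form (P i)" by (simp add: L_def)
      then show ?thesis unfolding F_lin[OF True] by (simp add: a_def c_def eval_linear_form)
    next
      case False
      then show ?thesis using eval_product_form[OF prod[OF False], of x] by (simp add: F_prod)
    qed
    then show "eval_system P x = F x" by (simp add: eval_system_def vec_eq_iff)
  qed
  have "normal_form_lfp L a c pj pk den len q"
  proof unfold_locales
    show "0 < q $ i" for i using pos by (simp add: vec_less_def)
    show "F q = q" using lfp F by (simp add: is_least_fixed_point_def)
    fix x :: "real^'n" and i
    assume "\<And>i. 0 \<le> x $ i" "\<And>i. x $ i \<le> 1" "F x = x"
    then have "q \<le> x"
      using lfp F by (auto simp: is_least_fixed_point_def less_eq_vec_def)
    then show "q $ i \<le> x $ i" by (simp add: less_eq_vec_def)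
  qed
  moreover have "dependency_graph P \<subseteq> edges"
  proof safe
    fix i j assume "(i, j) \<in> dependency_graph P"
    then obtain m where m: "0 < Poly_Mapping.lookup (P i) m" "0 < Poly_Mapping.lookup m j"
      by (auto simp: dependency_graph_def)
    show "(i, j) \<in> edges"
    proof (cases "i \<in> L")
      case True
      then have "linear_form (P i)" by (simp add: L_def)
      moreover have "m \<in> Poly_Mapping.keys (P i)" using m(1) by (simp add: in_keys_iff)
      ultimately have "m \<in> insert 0 (range variable)" using linear_form_keys by blast
      then have "m = variable j" using m(2) by (auto simp: lookup_variable split: if_splits)
      then have "0 < a i j" using m(1) by (simp add: a_def)
      then show ?thesis using True by (simp add: edges_def)
    next
      case False
      then have "m = variable (pj i) + variable (pk i)"
        using m(1) prod by (auto simp: lookup_single when_def split: if_splits)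
      then show ?thesis using False m(2)
        by (auto simp: edges_def lookup_add lookup_variable split: if_splits)
    qed
  qed
  ultimately show ?thesis using that F by blast
qed

theorem theorem4p5:
  fixes P :: "'n::finite system" and q :: "real^'n"
  assumes snf: "is_SNF_PPS P"
    and lfp: "is_least_fixed_point P q"
    and pos: "vec_less 0 q"
  shows "(vec_less q 1 \<longrightarrow>
           (\<forall>y. 0 \<le> y \<and> vec_less y 1 \<longrightarrow>
             (let A = mat 1 - system_jacobian P ((1/2) *\<^sub>R (y + q)) in
               invertible A \<and> nonneg_matrix (matrix_inv A) \<and>
               matrix_norm_inf (matrix_inv A)
                 \<le> 2 ^ (10 * encoding_length P)
                   * max (2 * inverse (vec_min (1 - y))) (2 ^ encoding_length P)))) \<and>
         (q = 1 \<and> strongly_connected_system P \<longrightarrow>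
           (\<forall>y. 0 \<le> y \<and> vec_less y 1 \<longrightarrow>
             (let A = mat 1 - system_jacobian P y in
               invertible A \<and> nonneg_matrix (matrix_inv A) \<and>
               matrix_norm_inf (matrix_inv A)
                 \<le> 2 ^ (4 * encoding_length P) * (1 / vec_min (1 - y)))))"
proof -
  define L where "L = {i. linear_form (P i)}"
  define a where "a i j = real_of_rat (Poly_Mapping.lookup (P i) (variable j))" for i j
  define c where "c i = real_of_rat (Poly_Mapping.lookup (P i) 0)" for i
  define den where "den i = (if linear_form (P i) then common_denominator (P i) else 1)" for i
  define len where "len i = polynomial_length (P i)" for i
  obtain pj pk where sys: "normal_form_lfp L a c pj pk den len q"
    and F: "eval_system P = normal_form_system.F L a c pj pk"
    and sub: "dependency_graph P \<subseteq> normal_form_system.edges L a pj pk"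
    using normal_form_lfp_system[OF snf lfp pos]
    unfolding L_def a_def c_def den_def len_def by blast
  interpret normal_form_lfp L a c pj pk den len q by (rule sys)
  \<comment> \<open>\<open>jacobian\<close> is built from the chosen Frechet derivative, which
    uniqueness identifies with \<open>J\<close>.\<close>
  have jac: "system_jacobian P x = J x" for x
    using F_has_derivative[of x]
    by (simp add: system_jacobian_def F jacobian_def frechet_derivative_at[symmetric])
  have len_sum: "encoding_length P = len_sum" by (simp add: encoding_length_def len_def)
  have vec_min_pos: "0 < vec_min (1 - y)" if "vec_less y 1" for y :: "real^'n"
    using vec_min_mem[of "1 - y"] that by (auto simp: vec_less_def)
  show ?thesis
  proof (intro conjI impI allI; elim conjE; unfold Let_def jac len_sum)
    fix y :: "real^'n"
    assume q1: "vec_less q 1" and y: "0 \<le> y" "vec_less y 1"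
    let ?N = "matrix_inv (mat 1 - J ((1/2) *\<^sub>R (y + q)))"
    have less: "q $ i < 1" "0 \<le> y $ i" "y $ i < 1" for i
      using q1 y by (auto simp: vec_less_def less_eq_vec_def)
    note bound = inverse_bound_less[OF less]
    have "matrix_norm_inf ?N \<le> 2 ^ (8 * len_sum) * (2 / vec_min (1 - y))" by (rule bound)
    also have "\<dots> \<le> 2 ^ (10 * len_sum) * max (2 * inverse (vec_min (1 - y))) (2 ^ len_sum)"
      using vec_min_pos[OF y(2)]
      by (intro mult_mono power_increasing) (auto simp: divide_inverse)
    finally show "invertible (mat 1 - J ((1/2) *\<^sub>R (y + q))) \<and> nonneg_matrix ?N \<and>
        matrix_norm_inf ?N \<le> 2 ^ (10 * len_sum) * max (2 * inverse (vec_min (1 - y))) (2 ^ len_sum)"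
      using bound by blast
  next
    fix y :: "real^'n"
    assume q1: "q = 1" and conn: "strongly_connected_system P" and y: "0 \<le> y" "vec_less y 1"
    let ?N = "matrix_inv (mat 1 - J y)"
    have less: "0 \<le> y $ i" "y $ i < 1" for i
      using y by (auto simp: vec_less_def less_eq_vec_def)
    have "(i, j) \<in> edges\<^sup>*" for i j
      using conn rtrancl_mono[OF sub] by (auto simp: strongly_connected_system_def)
    note bound = inverse_bound_eq_1[OF q1 this less]
    have "matrix_norm_inf ?N \<le> 2 ^ (3 * len_sum) * (1 / vec_min (1 - y))" by (rule bound)
    also have "\<dots> \<le> 2 ^ (4 * len_sum) * (1 / vec_min (1 - y))"
      using vec_min_pos[OF y(2)] by (intro mult_right_mono power_increasing) auto
    finally show "invertible (mat 1 - J y) \<and> nonneg_matrix ?N \<and>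
        matrix_norm_inf ?N \<le> 2 ^ (4 * len_sum) * (1 / vec_min (1 - y))"
      using bound by blast
  qed
qed

end
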